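(* Let $c_5(n)$ be defined by $$\sum_{n=0}^\infty c_5(n)q^n=\frac{1}{\Psi(-q^5,q)},\qquad \Psi(a,b):=\sum_{n=0}^\infty a^{n(n+1)/2} b^{n(n-1)/2}-\sum_{n=-\infty}^{-1} a^{n(n+1)/2}b^{n(n-1)/2}.$$ Then for all integers $n\ge 0$: $$c_5(32n+31)\equiv 0 \pmod 8,\quad c_5(128n+123)\equiv 0\pmod 8,\quad c_5(512n+491)\equiv 0\pmod 8,$$ $$c_5(64n+19)\equiv 0\pmod 4,\quad c_5(256n+75)\equiv 0 \pmod 4,$$ and $c_5(196n+i)\equiv 0\pmod 4$ for every $i\in\{110,138,194\}$.
   Context: $q$ is a complex variable with $|q|<1$ (equivalently, one may work with formal power series in $q$). Explicitly, $\Psi(-q^5,q)=\sum_{n\ge0}(-1)^{n(n+1)/2}q^{3n^2+2n}-\sum_{n\le -1}(-1)^{n(n+1)/2}q^{3n^2+2n}$, a power series with constant term $1$, so its reciprocal is a power series with integer coefficients $c_5(n)$. *)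

theory Defs
  imports "HOL-Analysis.Analysis" "HOL-Number_Theory.Cong"
begin

text \<open>
  The false theta function. Both exponents are non-negative for every integer \<open>n\<close>, and both
  divisions by 2 are exact, so neither \<open>nat\<close> nor \<open>div\<close> truncates anything. For formal power
  series the infinite sums are taken in the topology of coefficientwise convergence.
\<close>
definition Psi :: "'a \<Rightarrow> 'a \<Rightarrow> 'a :: {comm_ring_1, t2_space}" where
  "Psi a b =
     (\<Sum>\<^sub>\<infinity>n\<in>{0::int..}. a ^ nat (n * (n + 1) div 2) * b ^ nat (n * (n - 1) div 2)) -
     (\<Sum>\<^sub>\<infinity>n\<in>{..-1::int}. a ^ nat (n * (n + 1) div 2) * b ^ nat (n * (n - 1) div 2))"

text \<open>
  The series \<open>1 / \<Psi>(-q\<^sup>5, q)\<close> is formed in the rational power series, where division is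
  available; \<open>c5_gf\<close> below shows that its coefficients are integers.
\<close>
definition c5 :: "nat \<Rightarrow> int" where
  "c5 = (THE c. Abs_fps (\<lambda>n. rat_of_int (c n)) = 1 / Psi (- (fps_X ^ 5)) fps_X)"

lemma Psi_exponent:
  fixes n :: int
  shows "5 * nat (n * (n + 1) div 2) + nat (n * (n - 1) div 2) = nat (3 * n\<^sup>2 + 2 * n)"
proof -
  have "even (n * (n + 1))" "even (n * (n - 1))" by auto
  then obtain k l where k: "n * (n + 1) = 2 * k" and l: "n * (n - 1) = 2 * l"
    by (meson evenE)
  have "n * (n + 1) \<ge> 0" "n * (n - 1) \<ge> 0"
    by (cases "n \<ge> 1"; auto simp: zero_le_mult_iff)+
  then have "k \<ge> 0" "l \<ge> 0" using k l by simp_all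
  moreover have "3 * n\<^sup>2 + 2 * n = 5 * k + l"
    using k l by (simp add: power2_eq_square algebra_simps)
  ultimately show ?thesis unfolding k l by simp
qed

lemma Psi_term:
  fixes n :: int
  shows "(- (fps_X ^ 5)) ^ nat (n * (n + 1) div 2) * fps_X ^ nat (n * (n - 1) div 2) =
         fps_const ((-1) ^ nat (n * (n + 1) div 2)) * (fps_X :: rat fps) ^ nat (3 * n\<^sup>2 + 2 * n)"
proof -
  have "(- (fps_X ^ 5) :: rat fps) ^ k = fps_const ((-1) ^ k) * fps_X ^ (5 * k)" for k
  proof -
    have "fps_const ((-1) ^ k) = (-1 :: rat fps) ^ k"
      by (metis fps_const_power fps_const_neg fps_const_1_eq_1)
    then show ?thesis by (subst power_minus) (simp only: power_mult)
  qed
  then show ?thesis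
    by (simp only: mult.assoc flip: power_add Psi_exponent)
qed

lemma Psi_exponent_ge: "\<bar>n\<bar> \<le> 3 * n\<^sup>2 + 2 * n" for n :: int
proof -
  have "n * n \<ge> \<bar>n\<bar>"
    using self_le_power[of "\<bar>n\<bar>" 2] by (cases "n = 0") (auto simp: power2_eq_square)
  then show ?thesis by (auto simp: power2_eq_square abs_if split: if_splits)
qed

lemma Psi_part_has_sum:
  fixes A :: "int set"
  shows "((\<lambda>n. (- (fps_X ^ 5)) ^ nat (n * (n + 1) div 2) * fps_X ^ nat (n * (n - 1) div 2)) has_sum
          Abs_fps (\<lambda>k. rat_of_int (\<Sum>n | n \<in> A \<and> nat (3 * n\<^sup>2 + 2 * n) = k.
                                     (-1) ^ nat (n * (n + 1) div 2)))) A"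
proof (rule has_sum_fpsI)
  let ?F = "\<lambda>n::int. (- (fps_X ^ 5)) ^ nat (n * (n + 1) div 2) *
              (fps_X :: rat fps) ^ nat (n * (n - 1) div 2)"
  fix k :: nat
  have nth: "fps_nth (?F n) k =
      (if nat (3 * n\<^sup>2 + 2 * n) = k then (-1) ^ nat (n * (n + 1) div 2) else 0)" for n
    unfolding Psi_term by simp
  have eq: "{n \<in> A. fps_nth (?F n) k \<noteq> 0} = {n \<in> A. nat (3 * n\<^sup>2 + 2 * n) = k}"
    unfolding nth by auto
  have "{n \<in> A. nat (3 * n\<^sup>2 + 2 * n) = k} \<subseteq> {- int k..int k}"
  proof
    fix n assume "n \<in> {n \<in> A. nat (3 * n\<^sup>2 + 2 * n) = k}"
    with Psi_exponent_ge[of n] show "n \<in> {- int k..int k}" by auto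
  qed
  then show "finite {n \<in> A. fps_nth (?F n) k \<noteq> 0}"
    unfolding eq by (rule finite_subset) simp
  show "fps_nth (Abs_fps (\<lambda>k. rat_of_int (\<Sum>n | n \<in> A \<and> nat (3 * n\<^sup>2 + 2 * n) = k.
                                     (-1) ^ nat (n * (n + 1) div 2)))) k =
        (\<Sum>n | n \<in> A \<and> fps_nth (?F n) k \<noteq> 0. fps_nth (?F n) k)"
    unfolding eq by (simp add: nth)
qed

lemma Psi_exponent_eq_0_iff: "nat (3 * n\<^sup>2 + 2 * n) = 0 \<longleftrightarrow> n = 0" for n :: int
  using Psi_exponent_ge[of n] by auto

lemma Psi_eq:
  obtains p :: "int fps"
  where "Psi (- (fps_X ^ 5)) fps_X = Abs_fps (\<lambda>k. rat_of_int (fps_nth p k))"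
    and "\<And>k. fps_nth p k =
           (\<Sum>n | n \<ge> 0 \<and> nat (3 * n\<^sup>2 + 2 * n) = k. (-1) ^ nat (n * (n + 1) div 2)) -
           (\<Sum>n | n \<le> -1 \<and> nat (3 * n\<^sup>2 + 2 * n) = k. (-1) ^ nat (n * (n + 1) div 2))"
    and "fps_nth p 0 = 1"
proof -
  let ?c = "\<lambda>A k. \<Sum>n | n \<in> A \<and> nat (3 * n\<^sup>2 + 2 * n) = k. (-1) ^ nat (n * (n + 1) div 2) :: int"
  define p where "p = Abs_fps (\<lambda>k. ?c {0..} k - ?c {..-1} k)"
  have "Psi (- (fps_X ^ 5)) fps_X = Abs_fps (\<lambda>k. rat_of_int (fps_nth p k))"
    unfolding Psi_def infsumI[OF Psi_part_has_sum] p_def by (simp add: fps_eq_iff)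
  moreover have "{n \<in> {0::int..}. nat (3 * n\<^sup>2 + 2 * n) = 0} = {0}"
      "{n \<in> {..-1::int}. nat (3 * n\<^sup>2 + 2 * n) = 0} = {}"
    unfolding Psi_exponent_eq_0_iff by auto
  then have "fps_nth p 0 = 1" unfolding p_def fps_nth_Abs_fps by (simp only:) simp
  ultimately show thesis using that[of p] by (simp add: p_def)
qed

theorem c5_gf:
  "Abs_fps (\<lambda>n. rat_of_int (c5 n)) = 1 / Psi (- (fps_X ^ 5)) fps_X"
proof -
  let ?P = "Psi (- (fps_X ^ 5)) fps_X :: rat fps"
  obtain p where p: "?P = Abs_fps (\<lambda>k. rat_of_int (fps_nth p k))" "fps_nth p 0 = 1"
    by (rule Psi_eq)
  define r where "r = fps_right_inverse p 1"
  have "p * r = 1" unfolding r_def by (rule fps_right_inverse) (simp add: p)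
  have "Abs_fps (\<lambda>n. rat_of_int (fps_nth r n)) * ?P = 1"
  proof (rule fps_ext)
    fix n
    have "fps_nth (?P * Abs_fps (\<lambda>n. rat_of_int (fps_nth r n))) n = rat_of_int (fps_nth (p * r) n)"
      by (simp add: p(1) fps_mult_nth)
    then show "fps_nth (Abs_fps (\<lambda>n. rat_of_int (fps_nth r n)) * ?P) n = fps_nth 1 n"
      using \<open>p * r = 1\<close> by (simp add: mult.commute)
  qed
  moreover have "fps_nth ?P 0 \<noteq> 0" by (simp add: p)
  ultimately have "Abs_fps (\<lambda>n. rat_of_int (fps_nth r n)) = 1 / ?P"
    by (metis fps_divide_unit fps_inverse_unique mult.commute mult_1)
  moreover have "c = fps_nth r"
    if "Abs_fps (\<lambda>n. rat_of_int (c n)) = 1 / ?P" for c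
  proof
    fix n
    have "Abs_fps (\<lambda>n. rat_of_int (c n)) = Abs_fps (\<lambda>n. rat_of_int (fps_nth r n))"
      using that calculation by simp
    then show "c n = fps_nth r n" by (simp add: fps_eq_iff)
  qed
  ultimately show ?thesis
    unfolding c5_def by (rule theI)
qed

end

theory Submission
  imports Defs "HOL-Number_Theory.Number_Theory" "HOL-Library.Z2"
    "HOL-Computational_Algebra.Formal_Laurent_Series"
begin

text \<open>
  Let \<open>F = q \<Psi>(-q\<^sup>1\<^sup>5, q\<^sup>3) = \<Sum> \<plusminus>q\<^bsup>x\<^sup>2\<^esup>\<close> over \<open>x \<equiv> 1 (mod 3)\<close>, so that \<open>C F = q\<close> for
  \<open>C = \<Sum> c\<^sub>5(N) q\<^bsup>3N\<^esup>\<close>, and split \<open>F = E + D\<close> by the parity of \<open>x\<close>. Then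
  \<open>C (E\<^sup>4 - D\<^sup>4) = q (E - D) (E\<^sup>2 + D\<^sup>2)\<close>. Modulo 8 the fourth powers do not see the signs, and
  without signs the substitution \<open>x = u + v\<close>, \<open>y = u - v\<close> gives \<open>E\<^sup>4 - D\<^sup>4 = b g\<^sup>3\<close>, where
  \<open>b = \<Sum> (-1)\<^sup>x q\<^bsup>4x\<^sup>2\<^esup>\<close> over \<open>x \<equiv> 1 (mod 3)\<close> and \<open>g\<close> is the same sum over \<open>3 | x\<close>. Since
  \<open>b \<equiv> E (mod 2)\<close> and \<open>g\<^sup>4 \<equiv> 1 (mod 8)\<close>, the factor \<open>b\<close> can be cancelled. With \<open>M = 3N - 1\<close> this
  expresses \<open>c\<^sub>5(N)\<close>

  \<^item> modulo 8 for \<open>4 | M\<close> through representations of \<open>M / 4\<close> as a sum of three squares, of which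
    there are none for \<open>M / 4 = 4\<^sup>k (8 j + 7)\<close>;
  \<^item> modulo 4 for \<open>M \<equiv> 1 (mod 4)\<close> as twice the number of positive solutions of
    \<open>x\<^sup>2 + 4 y\<^sup>2 + 36 z\<^sup>2 = M\<close>, if \<open>M\<close> is not of the form \<open>x\<^sup>2 + 4 y\<^sup>2\<close>.

  In the last case let \<open>M = 7 k\<close> with a quadratic non-residue \<open>k\<close> modulo 7. For every \<open>z\<close>, the numbers of
  positive solutions of \<open>x\<^sup>2 + 4 y\<^sup>2 = n\<close> and of \<open>3 u\<^sup>2 + 7 v\<^sup>2 = 2 n\<close>, where \<open>n = M - 36 z\<^sup>2\<close>, have the same
  parity: both forms are alone in their genus, so the solutions correspond to square roots of \<open>-1\<close>
  and \<open>-21\<close> modulo the divisors \<open>n / g\<^sup>2\<close>. Finally, the solutions of \<open>3 u\<^sup>2 + 72 z\<^sup>2 + 7 v\<^sup>2 = 14 k\<close> are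
  paired off by a fixed point free involution, because 7 splits in \<open>\<rat>(\<surd>-6)\<close>.
\<close>

section \<open>Quadratic congruences and binary forms\<close>

text \<open>Over the two-element field \<open>bit\<close>, the sum of 1 over \<open>X\<close> is the
  cardinality, and the terms of \<open>x\<close> and \<open>h x\<close> cancel.\<close>

lemma even_card_involution:
  assumes "\<And>x. x \<in> X \<Longrightarrow> h x \<in> X" "\<And>x. x \<in> X \<Longrightarrow> h (h x) = x" "\<And>x. x \<in> X \<Longrightarrow> h x \<noteq> x"
  shows "even (card X)"
proof -
  have "(\<Sum>x\<in>X. 1 :: bit) = 0"
    by (rule sum_involution_eq_0[where h = h]) (use assms in auto)
  then have "(of_nat (card X) :: bit) = 0" by simp
  then show ?thesis by (cases "even (card X)") (auto elim!: oddE)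
qed

text \<open>Pigeonhole: the box of pairs \<open>(u, v)\<close> has more than \<open>m\<close>
  points, so two of them share the value of \<open>u - r * v\<close> modulo \<open>m\<close>; their
  difference is the required vector.\<close>

lemma thue:
  fixes m r U V :: int
  assumes "m > 0" "U \<ge> 0" "V \<ge> 0" "(U + 1) * (V + 1) > m"
  obtains u v where "(u, v) \<noteq> (0, 0)" "\<bar>u\<bar> \<le> U" "\<bar>v\<bar> \<le> V" "m dvd u - r * v"
proof -
  let ?f = "\<lambda>(u, v). (u - r * v) mod m"
  have "card ({0..<m}) < card ({0..U} \<times> {0..V})"
    using assms by (simp add: nat_less_iff flip: nat_mult_distrib)
  moreover have "?f ` ({0..U} \<times> {0..V}) \<subseteq> {0..<m}"
    using assms(1) by auto
  ultimately have "\<not> inj_on ?f ({0..U} \<times> {0..V})"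
    by (meson card_inj_on_le finite_atLeastLessThan_int leD)
  then obtain u v u' v' where *: "u \<in> {0..U}" "v \<in> {0..V}" "u' \<in> {0..U}" "v' \<in> {0..V}"
      "(u, v) \<noteq> (u', v')" "(u - r * v) mod m = (u' - r * v') mod m"
    unfolding inj_on_def by auto
  then have "m dvd (u - r * v) - (u' - r * v')" using mod_eq_dvd_iff by blast
  also have "\<dots> = (u - u') - r * (v - v')" by (simp add: algebra_simps)
  finally show thesis using that[of "u - u'" "v - v'"] * by auto
qed

section \<open>Diagonal binary forms and square roots modulo m\<close>

definition reps :: "int \<Rightarrow> int \<Rightarrow> int \<Rightarrow> (int \<times> int) set" where
  "reps \<alpha> \<beta> N = {(u, v). u > 0 \<and> v > 0 \<and> \<alpha> * u\<^sup>2 + \<beta> * v\<^sup>2 = N}"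

definition prim_reps :: "int \<Rightarrow> int \<Rightarrow> int \<Rightarrow> (int \<times> int) set" where
  "prim_reps \<alpha> \<beta> N = {(u, v) \<in> reps \<alpha> \<beta> N. coprime u v}"

text \<open>For \<open>m\<close> prime to \<alpha> these are the square roots of -\<beta>/\<alpha>
  modulo \<open>m\<close>, written without a division and as least residues.\<close>

definition qroots :: "int \<Rightarrow> int \<Rightarrow> int \<Rightarrow> int set" where
  "qroots \<alpha> \<beta> m = {r \<in> {0..<m}. m dvd \<alpha> * r\<^sup>2 + \<beta>}"

lemma finite_reps:
  assumes "\<alpha> > 0" "\<beta> > 0"
  shows "finite (reps \<alpha> \<beta> N)"
proof (rule finite_subset)
  show "reps \<alpha> \<beta> N \<subseteq> {0..N} \<times> {0..N}"
  proof (clarsimp simp: reps_def)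
    fix u v :: int assume *: "u > 0" "v > 0"
    have le: "y \<le> c * (y * y)" if "c > 0" "y > 0" for c y :: int
    proof -
      have "1 \<le> c * y" using mult_pos_pos[OF that] by simp
      then show ?thesis using mult_right_mono[of 1 "c * y" y] that by (simp add: mult_ac)
    qed
    have "u \<le> \<alpha> * (u * u)" "v \<le> \<beta> * (v * v)"
      using assms * by (simp_all add: le)
    moreover have "0 < \<alpha> * (u * u)" "0 < \<beta> * (v * v)" using assms * by simp_all
    ultimately show "u \<le> \<alpha> * u\<^sup>2 + \<beta> * v\<^sup>2 \<and> v \<le> \<alpha> * u\<^sup>2 + \<beta> * v\<^sup>2"
      by (simp add: power2_eq_square)
  qed
qed simp

lemma finite_qroots: "finite (qroots \<alpha> \<beta> m)"
  unfolding qroots_def by (rule finite_subset[of _ "{0..<m}"]) auto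

lemma qroots_minus:
  assumes "r \<in> qroots \<alpha> \<beta> m" "m > 0"
  shows "(- r) mod m \<in> qroots \<alpha> \<beta> m"
proof -
  have "m dvd \<alpha> * ((- r) mod m)\<^sup>2 + \<beta> \<longleftrightarrow> m dvd \<alpha> * (- r)\<^sup>2 + \<beta>"
    by (intro cong_dvd_iff cong_add cong_mult cong_pow) (auto simp: cong_def)
  then show ?thesis using assms by (simp add: qroots_def)
qed

text \<open>The roots pair off as \<open>r\<close> and \<open>- r\<close>. A fixed point would
  satisfy \<open>2 * r = 0\<close> modulo the odd \<open>m\<close>, and then \<open>m\<close> would
  divide \<beta>.\<close>

lemma even_card_qroots:
  assumes "m > 1" "odd m" "coprime m \<beta>"
  shows "even (card (qroots \<alpha> \<beta> m))"
proof (rule even_card_involution[where h = "\<lambda>r. (- r) mod m"])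
  fix r assume r: "r \<in> qroots \<alpha> \<beta> m"
  show "- r mod m \<in> qroots \<alpha> \<beta> m" using qroots_minus r assms by auto
  show "- (- r mod m) mod m = r" using r by (simp add: mod_minus_eq qroots_def)
  show "- r mod m \<noteq> r"
  proof
    assume eq: "- r mod m = r"
    then have "(- r) mod m = r mod m" by (metis mod_mod_trivial)
    then have "m dvd (- r) - r" by (simp add: mod_eq_dvd_iff)
    then have "m dvd 2 * r" by simp
    then have "m dvd r" using assms(2) by (simp add: coprime_dvd_mult_right_iff)
    then have "m dvd \<alpha> * r\<^sup>2" by (simp add: power2_eq_square)
    then have "m dvd \<beta>" using r by (simp add: qroots_def dvd_add_right_iff)
    then show False using assms by auto
  qed
qed

lemma form_pos_iff:
  fixes \<alpha> \<beta> x y :: int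
  assumes "\<alpha> > 0" "\<beta> > 0"
  shows "\<alpha> * x\<^sup>2 + \<beta> * y\<^sup>2 > 0 \<longleftrightarrow> (x, y) \<noteq> (0, 0)"
proof -
  have "\<alpha> * x\<^sup>2 \<ge> 0" "\<beta> * y\<^sup>2 \<ge> 0" "x \<noteq> 0 \<Longrightarrow> \<alpha> * x\<^sup>2 > 0" "y \<noteq> 0 \<Longrightarrow> \<beta> * y\<^sup>2 > 0"
    using assms by simp_all
  then show ?thesis using assms by (cases "x = 0"; cases "y = 0") (auto intro: add_pos_pos)
qed

text \<open>Gauss's correspondence: a primitive representation of \<open>\<gamma> m\<close> determines the square root
  \<open>u/v\<close> of \<open>-\<beta>/\<alpha>\<close> modulo \<open>m\<close>, and is recovered from it up to signs because
  \<open>\<gamma>\<^sup>2 < \<alpha> \<beta>\<close>.\<close>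
lemma card_qroots:
  fixes \<alpha> \<beta> \<gamma> m :: int
  assumes pos: "\<alpha> > 0" "\<beta> > 0" "\<gamma> > 0" "m > 1"
    and cop: "coprime m \<alpha>" "coprime m \<beta>" "odd m"
    and disc: "\<gamma>\<^sup>2 < \<alpha> * \<beta>"
    and ex: "\<And>r. m dvd \<alpha> * r\<^sup>2 + \<beta> \<Longrightarrow>
      \<exists>u v. m dvd u - r * v \<and> \<alpha> * u\<^sup>2 + \<beta> * v\<^sup>2 = \<gamma> * m \<and> coprime u v"
  shows "card (qroots \<alpha> \<beta> m) = 2 * card (prim_reps \<alpha> \<beta> (\<gamma> * m))"
proof -
  have copm: "coprime v m" if "coprime u v" "\<alpha> * u\<^sup>2 + \<beta> * v\<^sup>2 = \<gamma> * m" for u v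
  proof (rule coprimeI)
    fix d assume d: "d dvd v" "d dvd m"
    then have "d dvd (\<alpha> * u\<^sup>2 + \<beta> * v\<^sup>2) - \<beta> * v\<^sup>2"
      unfolding that(2) by (intro dvd_diff) (auto simp: power2_eq_square)
    then have "d dvd \<alpha> * (u * u)" by (simp add: power2_eq_square)
    moreover have "coprime d \<alpha>" "coprime d u"
      using d that(1) cop(1) by (meson coprime_divisors coprime_commute dvd_refl)+
    ultimately have "d dvd u" by (simp add: coprime_dvd_mult_right_iff)
    then show "is_unit d" using \<open>coprime d u\<close> coprime_absorb_left by blast
  qed
  have unique: "u * v' = u' * v"
    if "m dvd u - r * v" "m dvd u' - r * v'"
      "\<alpha> * u\<^sup>2 + \<beta> * v\<^sup>2 = \<gamma> * m" "\<alpha> * u'\<^sup>2 + \<beta> * v'\<^sup>2 = \<gamma> * m" for u v u' v' r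
  proof -
    have "m dvd (u - r * v) * v' - (u' - r * v') * v"
      by (rule dvd_diff) (simp_all add: that(1,2))
    then have "m dvd u * v' - u' * v" by (simp add: algebra_simps)
    then obtain t where t: "u * v' - u' * v = m * t" by (elim dvdE)
    \<comment> \<open>Brahmagupta's identity: the determinant is a multiple \<open>m * t\<close>,
      and a nonzero \<open>t\<close> would give \<alpha>\<beta> \<le> \<gamma>^2.\<close>
    have "(\<alpha> * u * u' + \<beta> * v * v')\<^sup>2 + \<alpha> * \<beta> * (u * v' - u' * v)\<^sup>2
        = (\<alpha> * u\<^sup>2 + \<beta> * v\<^sup>2) * (\<alpha> * u'\<^sup>2 + \<beta> * v'\<^sup>2)"
      by (simp add: power2_eq_square algebra_simps)
    also have "\<dots> = \<gamma>\<^sup>2 * m\<^sup>2" using that by (simp add: power2_eq_square)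
    finally have "\<alpha> * \<beta> * (m * t)\<^sup>2 \<le> \<gamma>\<^sup>2 * m\<^sup>2" unfolding t
      by (metis le_add_same_cancel2 zero_le_power2)
    then have "\<alpha> * \<beta> * t\<^sup>2 * m\<^sup>2 \<le> \<gamma>\<^sup>2 * m\<^sup>2" by (simp add: power_mult_distrib mult_ac)
    then have *: "\<alpha> * \<beta> * t\<^sup>2 \<le> \<gamma>\<^sup>2" using pos by simp
    have "t = 0"
    proof (rule ccontr)
      assume "t \<noteq> 0"
      then have "t\<^sup>2 \<ge> 1" by (simp add: int_one_le_iff_zero_less)
      then have "\<alpha> * \<beta> * 1 \<le> \<alpha> * \<beta> * t\<^sup>2" using pos by (intro mult_left_mono) auto
      then show False using * disc by simp
    qed
    then show ?thesis using t by simp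
  qed
  define recip where "recip v = (SOME w. [v * w = 1] (mod m))" for v
  have recip: "[v * recip v = 1] (mod m)" if "coprime v m" for v
    unfolding recip_def by (rule someI_ex) (use that cong_solve_coprime_int in blast)
  \<comment> \<open>A positive pair and a sign \<open>s\<close> are sent to the root
    \<open>s * u / v\<close>; the two signs account for the factor 2 in the count.\<close>
  define h where "h = (\<lambda>((u, v), s). (s * u * recip v) mod m)"
  have h_dvd: "m dvd s * u - h ((u, v), s) * v"
    if "(u, v) \<in> prim_reps \<alpha> \<beta> (\<gamma> * m)" for u v s
  proof -
    have "coprime v m" using that copm by (auto simp: prim_reps_def reps_def)
    from cong_scalar_left[OF recip[OF this], of "s * u"]
    have "[(s * u * recip v) * v = s * u] (mod m)" by (simp add: mult_ac)
    then have "[h ((u, v), s) * v = s * u] (mod m)" by (simp add: h_def cong_def mod_mult_left_eq)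
    then show ?thesis by (simp add: cong_iff_dvd_diff dvd_diff_commute)
  qed
  have "bij_betw h (prim_reps \<alpha> \<beta> (\<gamma> * m) \<times> {1, -1}) (qroots \<alpha> \<beta> m)"
    unfolding bij_betw_def
  proof
    show "inj_on h (prim_reps \<alpha> \<beta> (\<gamma> * m) \<times> {1, -1})"
    proof (rule inj_onI)
      fix x y
      assume "x \<in> prim_reps \<alpha> \<beta> (\<gamma> * m) \<times> {1, -1}"
        and "y \<in> prim_reps \<alpha> \<beta> (\<gamma> * m) \<times> {1, -1}" and "h x = h y"
      then obtain u v s u' v' s' where xy: "x = ((u, v), s)" "y = ((u', v'), s')"
        and P: "(u, v) \<in> prim_reps \<alpha> \<beta> (\<gamma> * m)" "(u', v') \<in> prim_reps \<alpha> \<beta> (\<gamma> * m)"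
        and s: "s \<in> {1, -1 :: int}" "s' \<in> {1, -1 :: int}" and eq: "h ((u, v), s) = h ((u', v'), s')"
        by (metis SigmaE surj_pair)
      have pos': "u > 0" "v > 0" "u' > 0" "v' > 0" "coprime u v" "coprime u' v'"
        and form: "\<alpha> * u\<^sup>2 + \<beta> * v\<^sup>2 = \<gamma> * m" "\<alpha> * u'\<^sup>2 + \<beta> * v'\<^sup>2 = \<gamma> * m"
        using P by (auto simp: prim_reps_def reps_def)
      have "(s * u)\<^sup>2 = u\<^sup>2" "(s' * u')\<^sup>2 = u'\<^sup>2" using s by auto
      then have "(s * u) * v' = (s' * u') * v"
        using h_dvd[OF P(1), of s] h_dvd[OF P(2), of s'] form
        unfolding eq by (intro unique[where r = "h ((u', v'), s')"]) auto
      moreover have "u * v' > 0" "u' * v > 0" using pos' by simp_all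
      ultimately have ss: "s = s'" and *: "u * v' = u' * v" using s by auto
      have "u dvd u' * v" "u' dvd u * v'" "v dvd v' * u" "v' dvd v * u'"
        using * by (metis dvd_triv_left dvd_triv_right mult.commute)+
      then have "u dvd u'" "u' dvd u" "v dvd v'" "v' dvd v"
        using pos'(5,6) coprime_dvd_mult_left_iff coprime_commute by blast+
      then show "x = y" using pos' ss unfolding xy
        by (simp add: zdvd_antisym_nonneg)
    qed
    show "h ` (prim_reps \<alpha> \<beta> (\<gamma> * m) \<times> {1, -1}) = qroots \<alpha> \<beta> m"
    proof (intro equalityI subsetI)
      fix r assume "r \<in> h ` (prim_reps \<alpha> \<beta> (\<gamma> * m) \<times> {1, -1})"
      then obtain u v s where P: "(u, v) \<in> prim_reps \<alpha> \<beta> (\<gamma> * m)" and s: "s \<in> {1, -1}"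
        and r: "r = h ((u, v), s)" by auto
      have d: "m dvd s * u - r * v" using h_dvd[OF P] r by simp
      have uv: "\<alpha> * u\<^sup>2 + \<beta> * v\<^sup>2 = \<gamma> * m" "coprime v m"
        using P copm by (auto simp: prim_reps_def reps_def)
      have "(\<alpha> * r\<^sup>2 + \<beta>) * v\<^sup>2 = \<gamma> * m - \<alpha> * (s * u - r * v) * (s * u + r * v)"
        using uv(1) s by (auto simp: power2_eq_square algebra_simps)
      also have "m dvd \<dots>" using d by (intro dvd_diff) auto
      finally have "m dvd \<alpha> * r\<^sup>2 + \<beta>"
        using uv(2) by (simp add: coprime_dvd_mult_left_iff coprime_commute)
      then show "r \<in> qroots \<alpha> \<beta> m" using pos unfolding r h_def qroots_def by auto
    next
      fix r assume r: "r \<in> qroots \<alpha> \<beta> m"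
      then obtain u v where uv: "m dvd u - r * v" "\<alpha> * u\<^sup>2 + \<beta> * v\<^sup>2 = \<gamma> * m" "coprime u v"
        using ex[of r] by (auto simp: qroots_def)
      have "u \<noteq> 0"
      proof
        assume "u = 0"
        then have "coprime v m" using copm[OF uv(3,2)] by simp
        moreover have "m dvd r * v" using uv \<open>u = 0\<close> by simp
        ultimately have "m dvd r" using coprime_commute coprime_dvd_mult_left_iff by blast
        then have "r = 0" using r by (auto simp: qroots_def dest: zdvd_imp_le)
        then have "m dvd \<beta>" using r by (simp add: qroots_def)
        then show False using cop pos by auto
      qed
      moreover have "v \<noteq> 0"
      proof
        assume "v = 0"
        then show False using copm[OF uv(3,2)] pos by simp
      qed
      \<comment> \<open>The vector \<open>(u, v)\<close> may have negative entries; the root depends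
        on the sign of \<open>u / v\<close>, which \<open>s\<close> records.\<close>
      define s where "s = sgn u * sgn v"
      have s: "s \<in> {1, -1}" using \<open>u \<noteq> 0\<close> \<open>v \<noteq> 0\<close> by (auto simp: s_def sgn_if)
      have P: "(\<bar>u\<bar>, \<bar>v\<bar>) \<in> prim_reps \<alpha> \<beta> (\<gamma> * m)"
        using uv \<open>u \<noteq> 0\<close> \<open>v \<noteq> 0\<close> by (auto simp: prim_reps_def reps_def)
      have "s * \<bar>u\<bar> - r * \<bar>v\<bar> = sgn v * (u - r * v)"
        by (auto simp: s_def sgn_if abs_if algebra_simps)
      then have "m dvd s * \<bar>u\<bar> - r * \<bar>v\<bar>" using uv by simp
      from dvd_diff[OF this h_dvd[OF P, of s]]
      have "m dvd (h ((\<bar>u\<bar>, \<bar>v\<bar>), s) - r) * \<bar>v\<bar>" by (simp add: algebra_simps)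
      moreover have "coprime m \<bar>v\<bar>" using copm[OF uv(3,2)] by (simp add: coprime_commute)
      ultimately have "m dvd h ((\<bar>u\<bar>, \<bar>v\<bar>), s) - r" by (metis coprime_dvd_mult_left_iff)
      then have "h ((\<bar>u\<bar>, \<bar>v\<bar>), s) mod m = r mod m" by (simp add: mod_eq_dvd_iff)
      then have "h ((\<bar>u\<bar>, \<bar>v\<bar>), s) = r" using r by (simp add: h_def qroots_def)
      then show "r \<in> h ` (prim_reps \<alpha> \<beta> (\<gamma> * m) \<times> {1, -1})" using P s
        by (metis SigmaI image_eqI)
    qed
  qed
  then have "card (qroots \<alpha> \<beta> m) = card (prim_reps \<alpha> \<beta> (\<gamma> * m) \<times> {1, -1 :: int})"
    by (simp add: bij_betw_same_card)
  then show ?thesis by (simp add: card_cartesian_product)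
qed

section \<open>Primitive representations attached to a root\<close>

text \<open>Let g be the gcd, u = g a, v = g b, m = g^2 m'. Then g m' divides both a - r b and
  \<alpha> r^2 + \<beta>, hence also \<alpha> a^2 + \<beta> b^2 = \<gamma> m'. So g divides \<gamma>
  and m, which are coprime.\<close>

lemma coprime_of_root:
  fixes \<alpha> \<beta> \<gamma> m r u v :: int
  assumes root: "m dvd \<alpha> * r\<^sup>2 + \<beta>" and lat: "m dvd u - r * v"
    and eq: "\<alpha> * u\<^sup>2 + \<beta> * v\<^sup>2 = \<gamma> * m" and "m > 0" "\<gamma> > 0" "coprime \<gamma> m"
    and sqf: "\<And>g. g\<^sup>2 dvd \<gamma> * m \<Longrightarrow> g\<^sup>2 dvd m"
  shows "coprime u v"
proof -
  define g where "g = gcd u v"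
  have "g \<noteq> 0" using eq assms by (auto simp: g_def)
  obtain a b where ab: "u = g * a" "v = g * b"
    unfolding g_def by (meson dvdE gcd_dvd1 gcd_dvd2)
  have "\<gamma> * m = g\<^sup>2 * (\<alpha> * a\<^sup>2 + \<beta> * b\<^sup>2)"
    using eq unfolding ab by (simp add: power2_eq_square algebra_simps)
  then obtain m' where m': "m = g\<^sup>2 * m'" using sqf by (metis dvd_triv_left dvdE)
  then have "m' \<noteq> 0" using \<open>m > 0\<close> by auto
  have 1: "\<alpha> * a\<^sup>2 + \<beta> * b\<^sup>2 = \<gamma> * m'"
    using \<open>\<gamma> * m = _\<close> \<open>g \<noteq> 0\<close> unfolding m' by (simp add: mult_ac)
  have "g * (g * m') dvd g * (a - r * b)"
    using lat unfolding m' ab by (simp add: power2_eq_square algebra_simps)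
  then have "g * m' dvd a - r * b" using \<open>g \<noteq> 0\<close> by simp
  moreover have "g * m' dvd \<alpha> * r\<^sup>2 + \<beta>"
    using root unfolding m' by (metis dvd_trans dvd_triv_right mult.assoc power2_eq_square)
  ultimately have "g * m' dvd \<alpha> * (a + r * b) * (a - r * b) + b\<^sup>2 * (\<alpha> * r\<^sup>2 + \<beta>)"
    by (metis dvd_add dvd_mult)
  also have "\<dots> = \<gamma> * m'" unfolding 1[symmetric] by (simp add: power2_eq_square algebra_simps)
  finally have "g dvd \<gamma>" using \<open>m' \<noteq> 0\<close> by simp
  moreover have "g dvd m" unfolding m' by (simp add: power2_eq_square)
  ultimately have "is_unit g" using \<open>coprime \<gamma> m\<close> coprime_common_divisor by blast
  then show ?thesis by (simp add: g_def coprime_iff_gcd_eq_1)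
qed

text \<open>\<open>U\<close> is the integer part of the square root of \<open>a / b\<close>; it
  serves as a side of the box in \<open>thue\<close>.\<close>

lemma ex_floor_sqrt:
  fixes a b :: int
  assumes "a \<ge> 0" "b > 0"
  obtains U where "U \<ge> 0" "b * U\<^sup>2 \<le> a" "a < b * (U + 1)\<^sup>2"
proof -
  define P where "P k \<longleftrightarrow> a < b * (int k + 1)\<^sup>2" for k :: nat
  have "a < (a + 1) * 1" by simp
  also have "\<dots> \<le> (a + 1) * (b * (a + 1))"
    using assms by (intro mult_left_mono) (auto simp: int_one_le_iff_zero_less)
  finally have "P (nat a)" using assms by (simp add: P_def power2_eq_square mult_ac)
  then have 1: "P (LEAST k. P k)" by (rule LeastI)
  define k where "k = (LEAST k. P k)"
  have "b * (int k)\<^sup>2 \<le> a"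
  proof (cases k)
    case (Suc j)
    then have "\<not> P j" unfolding k_def by (intro not_less_Least) simp
    then show ?thesis by (simp add: P_def Suc add.commute)
  qed (use assms in simp)
  then show thesis using that[of "int k"] 1 by (simp add: P_def k_def)
qed

lemma dvd_form_of_root:
  fixes \<alpha> \<beta> m r u v :: int
  assumes "m dvd \<alpha> * r\<^sup>2 + \<beta>" "m dvd u - r * v"
  shows "m dvd \<alpha> * u\<^sup>2 + \<beta> * v\<^sup>2"
proof -
  have "m dvd \<alpha> * (u + r * v) * (u - r * v) + v\<^sup>2 * (\<alpha> * r\<^sup>2 + \<beta>)"
    by (intro dvd_add dvd_mult assms)
  also have "\<dots> = \<alpha> * u\<^sup>2 + \<beta> * v\<^sup>2" by (simp add: power2_eq_square algebra_simps)
  finally show ?thesis .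
qed

lemma mod_square_cases:
  fixes x :: int
  shows "x\<^sup>2 mod 3 \<in> {0, 1}" "x\<^sup>2 mod 4 \<in> {0, 1}" "x\<^sup>2 mod 7 \<in> {0, 1, 2, 4}"
    "x\<^sup>2 mod 8 \<in> {0, 1, 4}" "x\<^sup>2 mod 16 \<in> {0, 1, 4, 9}"
proof -
  have e: "x\<^sup>2 mod n = (x mod n)\<^sup>2 mod n" for n by (simp add: power_mod)
  have "x mod 3 \<in> {0, 1, 2}" by simp presburger
  then show "x\<^sup>2 mod 3 \<in> {0, 1}" unfolding e[of 3] by (elim insertE emptyE) simp_all
  have "x mod 4 \<in> {0, 1, 2, 3}" by simp presburger
  then show "x\<^sup>2 mod 4 \<in> {0, 1}" unfolding e[of 4] by (elim insertE emptyE) simp_all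
  have "x mod 7 \<in> {0, 1, 2, 3, 4, 5, 6}" by simp presburger
  then show "x\<^sup>2 mod 7 \<in> {0, 1, 2, 4}" unfolding e[of 7] by (elim insertE emptyE) simp_all
  have "x mod 8 \<in> {0, 1, 2, 3, 4, 5, 6, 7}" by simp presburger
  then show "x\<^sup>2 mod 8 \<in> {0, 1, 4}" unfolding e[of 8] by (elim insertE emptyE) simp_all
  have "x mod 16 \<in> {0, 1, 2, 3, 4, 5, 6, 7, 8, 9, 10, 11, 12, 13, 14, 15}" by simp presburger
  then show "x\<^sup>2 mod 16 \<in> {0, 1, 4, 9}" unfolding e[of 16] by (elim insertE emptyE) simp_all
qed

text \<open>The finite check behind \<open>multiplier_cases\<close>, on residues alone; the digit in
  a name is the modulus. Modulo 7 both 3 and \<open>m\<close> are non-residues, so \<open>j\<close>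
  is zero or a residue; modulo 3, \<open>j\<close> is not 1. This leaves 2, 8 and 9, and modulo 4
  the value 9 is impossible, while 8 needs both squares to be even.\<close>

lemma multiplier_residues:
  fixes j a4 a7 b3 b4 m7 :: int
  assumes j: "j \<in> {1, 2, 3, 4, 5, 6, 7, 8, 9}"
    and a4: "a4 \<in> {0, 1}" and b4: "b4 \<in> {0, 1}"
    and a7: "a7 \<in> {0, 1, 2, 4}" and b3: "b3 \<in> {0, 1}"
    and m: "m7 \<in> {3, 5, 6}"
    and e: "(3 * a7) mod 7 = (j * m7) mod 7" "b3 = (j * 2) mod 3" "(3 * a4 + 3 * b4) mod 4 = j mod 4"
  shows "j = 2 \<or> j = 8 \<and> a4 = 0 \<and> b4 = 0"
proof -
  have "(3 * a7) mod 7 \<in> {0, 3, 5, 6}" using a7 by auto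
  then have j7: "(j * m7) mod 7 \<in> {0, 3, 5, 6}" using e(1) by simp
  have j3: "(j * 2) mod 3 \<in> {0, 1}" using b3 e(2) by simp
  have "j \<in> {2, 3, 5, 6, 8, 9}" using j j3 by (elim insertE) simp_all
  then have "j \<in> {2, 8, 9}" using m j7 by (elim insertE[of j] insertE[of m7] emptyE) simp_all
  moreover have "j \<noteq> 9" using e(3) a4 b4 by auto
  moreover have "a4 = 0 \<and> b4 = 0" if "j = 8" using e(3) a4 b4 unfolding that by auto
  ultimately show ?thesis by auto
qed

lemma multiplier_cases:
  fixes a b m j :: int
  assumes eq: "3 * a + 7 * b = j * m" and j: "j \<in> {1, 2, 3, 4, 5, 6, 7, 8, 9}"
    and sq: "a mod 4 \<in> {0, 1}" "b mod 4 \<in> {0, 1}" "a mod 7 \<in> {0, 1, 2, 4}" "b mod 3 \<in> {0, 1}"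
    and m: "m mod 3 = 2" "m mod 4 = 1" "m mod 7 \<in> {3, 5, 6}"
  shows "j = 2 \<or> j = 8 \<and> a mod 4 = 0 \<and> b mod 4 = 0"
proof (rule multiplier_residues[OF j sq m(3)])
  have "(3 * (a mod 7)) mod 7 = (3 * a + 7 * b) mod 7" by (simp add: mod_mult_right_eq)
  also have "\<dots> = (j * (m mod 7)) mod 7" unfolding eq by (rule mod_mult_right_eq[symmetric])
  finally show "(3 * (a mod 7)) mod 7 = (j * (m mod 7)) mod 7" .
  have "b mod 3 = (b + 3 * (a + 2 * b)) mod 3" by (rule mod_mult_self2[symmetric])
  also have "b + 3 * (a + 2 * b) = j * m" using eq by simp
  also have "(j * m) mod 3 = (j * (m mod 3)) mod 3" by (rule mod_mult_right_eq[symmetric])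
  finally show "b mod 3 = (j * 2) mod 3" unfolding m .
  have "(3 * (a mod 4) + 3 * (b mod 4)) mod 4 = (3 * a + 3 * b) mod 4"
    by (rule mod_add_cong[OF mod_mult_right_eq mod_mult_right_eq])
  also have "\<dots> = (3 * a + 3 * b + 4 * b) mod 4" by (rule mod_mult_self2[symmetric])
  also have "3 * a + 3 * b + 4 * b = j * m" using eq by simp
  also have "(j * m) mod 4 = (j * (m mod 4)) mod 4" by (rule mod_mult_right_eq[symmetric])
  finally show "(3 * (a mod 4) + 3 * (b mod 4)) mod 4 = j mod 4" unfolding m by simp
qed

lemma square_dvd_double:
  fixes g n :: int
  assumes "odd n" "g\<^sup>2 dvd 2 * n"
  shows "g\<^sup>2 dvd n"
proof -
  have "odd g"
  proof
    assume "even g"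
    then have "2 * 2 dvd g\<^sup>2" unfolding power2_eq_square by (intro mult_dvd_mono)
    then have "2 * 2 dvd 2 * n" using assms(2) by (rule dvd_trans)
    then show False using assms(1) by presburger
  qed
  then have "coprime (g\<^sup>2) 2" by simp
  then show ?thesis using assms(2) coprime_dvd_mult_right_iff by blast
qed

text \<open>\<open>thue\<close> in a box with sides near sqrt(3m/2) and sqrt(2m/3) yields 3u^2 +
  7v^2 = j m with j < 10, since 9/2 + 14/3 < 10. The congruences leave j = 2, and j = 8 with
  \<open>u\<close> and \<open>v\<close> even, where halving the vector gives the multiplier 2
  again.\<close>

lemma ex_rep_3_7:
  fixes m r :: int
  assumes m: "m > 0" "m mod 12 = 5" "m mod 7 \<in> {3, 5, 6}" and root: "m dvd 3 * r\<^sup>2 + 7"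
  shows "\<exists>u v. m dvd u - r * v \<and> 3 * u\<^sup>2 + 7 * v\<^sup>2 = 2 * m \<and> coprime u v"
proof -
  have "odd m" using m(2) by presburger
  obtain U where U: "U \<ge> 0" "2 * U\<^sup>2 \<le> 3 * m" "3 * m < 2 * (U + 1)\<^sup>2"
    using ex_floor_sqrt[of "3 * m" 2] m by auto
  obtain V where V: "V \<ge> 0" "3 * V\<^sup>2 \<le> 2 * m" "2 * m < 3 * (V + 1)\<^sup>2"
    using ex_floor_sqrt[of "2 * m" 3] m by auto
  have "(3 * m) * (2 * m) < (2 * (U + 1)\<^sup>2) * (3 * (V + 1)\<^sup>2)"
    by (rule mult_strict_mono) (use U V m in linarith)+
  moreover have "(3 * m) * (2 * m) = 6 * m\<^sup>2" by (simp add: power2_eq_square)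
  moreover have "(2 * (U + 1)\<^sup>2) * (3 * (V + 1)\<^sup>2) = 6 * ((U + 1) * (V + 1))\<^sup>2"
    by (simp add: power_mult_distrib)
  ultimately have "m\<^sup>2 < ((U + 1) * (V + 1))\<^sup>2" by linarith
  then have "(U + 1) * (V + 1) > m" using power2_less_imp_less[of m "(U + 1) * (V + 1)"] U(1) V(1) by simp
  then obtain u v where uv: "(u, v) \<noteq> (0, 0)" "\<bar>u\<bar> \<le> U" "\<bar>v\<bar> \<le> V" "m dvd u - r * v"
    using thue[of m U V r] m U V by metis
  have "u\<^sup>2 \<le> U\<^sup>2" "v\<^sup>2 \<le> V\<^sup>2" using uv by (metis abs_ge_zero power2_abs power_mono)+
  then have le: "6 * (3 * u\<^sup>2 + 7 * v\<^sup>2) < 60 * m" using U(2) V(2) m(1) by (simp add: algebra_simps)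
  obtain j where j: "3 * u\<^sup>2 + 7 * v\<^sup>2 = j * m"
    using dvd_form_of_root[OF root uv(4)] by (metis dvdE mult.commute)
  have "0 < j * m" using form_pos_iff[of 3 7 u v] uv(1) j by simp
  then have "j > 0" using m by (simp add: zero_less_mult_iff)
  moreover have "j * m < 10 * m" using le j by simp
  then have "j < 10" using m by simp
  ultimately have "j \<in> {1, 2, 3, 4, 5, 6, 7, 8, 9}" by auto
  moreover have "m mod 3 = 2" "m mod 4 = 1" using m(2) by presburger+
  ultimately have "j = 2 \<or> j = 8 \<and> u\<^sup>2 mod 4 = 0 \<and> v\<^sup>2 mod 4 = 0"
    by (intro multiplier_cases[OF j _ mod_square_cases(2) mod_square_cases(2) mod_square_cases(3) mod_square_cases(1)] m(3))
  then obtain u v where uv: "m dvd u - r * v" "3 * u\<^sup>2 + 7 * v\<^sup>2 = 2 * m"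
  proof (elim disjE conjE)
    assume "j = 8" and "u\<^sup>2 mod 4 = 0" "v\<^sup>2 mod 4 = 0"
    then have "even (u\<^sup>2)" "even (v\<^sup>2)" by (metis dvd_mod_imp_dvd dvd_0_right even_numeral)+
    then obtain u' v' where uv': "u = 2 * u'" "v = 2 * v'" by (auto elim!: evenE)
    have "m dvd 2 * (u' - r * v')" using uv(4) unfolding uv' by (simp add: algebra_simps)
    then have "m dvd u' - r * v'"
      using \<open>odd m\<close> coprime_dvd_mult_right_iff coprime_right_2_iff_odd by blast
    moreover have "3 * u'\<^sup>2 + 7 * v'\<^sup>2 = 2 * m" using j \<open>j = 8\<close> unfolding uv' by simp
    ultimately show thesis by (rule that)
  qed (use uv(4) j that in auto)
  moreover have "coprime u v"
  proof (rule coprime_of_root[OF root uv m(1)])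
    show "coprime 2 m" using \<open>odd m\<close> by simp
    show "g\<^sup>2 dvd m" if "g\<^sup>2 dvd 2 * m" for g
      using square_dvd_double[OF \<open>odd m\<close> that] .
  qed simp
  ultimately show ?thesis by blast
qed

text \<open>\<open>thue\<close> in a box with sides near sqrt(2m) and sqrt(m/2) yields u^2 + 4v^2 =
  j m with j \<le> 4. As u^2 = j modulo 4, the candidates are 1 and 4. The value 4 needs equality in
  both bounds, so u^2 = 2m, which is 2 modulo 4.\<close>

lemma ex_rep_1_4:
  fixes m r :: int
  assumes m: "m > 0" "m mod 4 = 1" and root: "m dvd 1 * r\<^sup>2 + 4"
  shows "\<exists>u v. m dvd u - r * v \<and> 1 * u\<^sup>2 + 4 * v\<^sup>2 = 1 * m \<and> coprime u v"
proof -
  obtain U where U: "U \<ge> 0" "1 * U\<^sup>2 \<le> 2 * m" "2 * m < 1 * (U + 1)\<^sup>2"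
    using ex_floor_sqrt[of "2 * m" 1] m by auto
  obtain V where V: "V \<ge> 0" "2 * V\<^sup>2 \<le> m" "m < 2 * (V + 1)\<^sup>2"
    using ex_floor_sqrt[of m 2] m by auto
  have "(2 * m) * m < (1 * (U + 1)\<^sup>2) * (2 * (V + 1)\<^sup>2)"
    by (rule mult_strict_mono) (use U V m in linarith)+
  moreover have "(2 * m) * m = 2 * m\<^sup>2" by (simp add: power2_eq_square)
  moreover have "(1 * (U + 1)\<^sup>2) * (2 * (V + 1)\<^sup>2) = 2 * ((U + 1) * (V + 1))\<^sup>2"
    by (simp add: power_mult_distrib)
  ultimately have "m\<^sup>2 < ((U + 1) * (V + 1))\<^sup>2" by linarith
  then have "(U + 1) * (V + 1) > m" using power2_less_imp_less[of m "(U + 1) * (V + 1)"] U(1) V(1) by simp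
  then obtain u v where uv: "(u, v) \<noteq> (0, 0)" "\<bar>u\<bar> \<le> U" "\<bar>v\<bar> \<le> V" "m dvd u - r * v"
    using thue[of m U V r] m U V by metis
  have "u\<^sup>2 \<le> U\<^sup>2" "v\<^sup>2 \<le> V\<^sup>2" using uv by (metis abs_ge_zero power2_abs power_mono)+
  then have le: "u\<^sup>2 \<le> 2 * m" "4 * v\<^sup>2 \<le> 2 * m" using U(2) V(2) by linarith+
  obtain j where j: "1 * u\<^sup>2 + 4 * v\<^sup>2 = j * m"
    using dvd_form_of_root[OF root uv(4)] by (metis dvdE mult.commute)
  have "0 < j * m" using form_pos_iff[of 1 4 u v] uv(1) j by simp
  then have "j > 0" using m by (simp add: zero_less_mult_iff)
  moreover have "j * m \<le> 4 * m" using le j by simp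
  then have "j \<le> 4" using m by simp
  ultimately have "j \<in> {1, 2, 3, 4}" by auto
  moreover have "u\<^sup>2 mod 4 = j mod 4"
  proof -
    have "(u\<^sup>2 + 4 * v\<^sup>2) mod 4 = (j * (m mod 4)) mod 4" using j by (simp add: mod_mult_right_eq)
    then show ?thesis using m(2) by simp
  qed
  moreover have "u\<^sup>2 mod 4 \<in> {0, 1}" by (rule mod_square_cases)
  moreover have "j \<noteq> 4"
  proof
    assume "j = 4"
    then have "u\<^sup>2 = 2 * m" using le j by simp
    then have "u\<^sup>2 mod 4 = 2" using m(2) by presburger
    then show False using \<open>u\<^sup>2 mod 4 \<in> {0, 1}\<close> by simp
  qed
  ultimately have "j = 1" by auto
  then show ?thesis using j uv(4) coprime_of_root[OF root uv(4), of 1] m by auto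
qed

section \<open>The number of roots modulo products and prime powers\<close>

text \<open>The Chinese remainder theorem: reducing a root modulo both factors is a
  bijection.\<close>

lemma card_qroots_mult:
  assumes "m1 > 0" "m2 > 0" "coprime m1 m2"
  shows "card (qroots \<alpha> \<beta> (m1 * m2)) = card (qroots \<alpha> \<beta> m1) * card (qroots \<alpha> \<beta> m2)"
proof -
  let ?h = "\<lambda>r. (r mod m1, r mod m2)"
  have dvd_mod: "m dvd \<alpha> * (r mod m)\<^sup>2 + \<beta> \<longleftrightarrow> m dvd \<alpha> * r\<^sup>2 + \<beta>" for m r :: int
    by (intro cong_dvd_iff cong_add cong_mult cong_pow) (auto simp: cong_def)
  have "bij_betw ?h (qroots \<alpha> \<beta> (m1 * m2)) (qroots \<alpha> \<beta> m1 \<times> qroots \<alpha> \<beta> m2)"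
    unfolding bij_betw_def
  proof
    show "inj_on ?h (qroots \<alpha> \<beta> (m1 * m2))"
    proof (rule inj_onI)
      fix r s assume rs: "r \<in> qroots \<alpha> \<beta> (m1 * m2)" "s \<in> qroots \<alpha> \<beta> (m1 * m2)" and "?h r = ?h s"
      then have "m1 dvd r - s" "m2 dvd r - s" by (simp_all add: mod_eq_dvd_iff)
      then have "m1 * m2 dvd r - s" using assms(3) by (simp add: divides_mult)
      then have "r mod (m1 * m2) = s mod (m1 * m2)" by (simp add: mod_eq_dvd_iff)
      then show "r = s" using rs by (simp add: qroots_def)
    qed
    show "?h ` qroots \<alpha> \<beta> (m1 * m2) = qroots \<alpha> \<beta> m1 \<times> qroots \<alpha> \<beta> m2"
    proof (intro equalityI subsetI)
      fix y assume "y \<in> ?h ` qroots \<alpha> \<beta> (m1 * m2)"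
      then obtain r where r: "r \<in> qroots \<alpha> \<beta> (m1 * m2)" "y = ?h r" by auto
      then have "m1 dvd \<alpha> * r\<^sup>2 + \<beta>" "m2 dvd \<alpha> * r\<^sup>2 + \<beta>"
        by (auto simp: qroots_def intro: dvd_trans[OF dvd_triv_left] dvd_trans[OF dvd_triv_right])
      then show "y \<in> qroots \<alpha> \<beta> m1 \<times> qroots \<alpha> \<beta> m2"
        using assms r(2) by (simp add: qroots_def dvd_mod)
    next
      fix y assume "y \<in> qroots \<alpha> \<beta> m1 \<times> qroots \<alpha> \<beta> m2"
      then obtain r s where y: "y = (r, s)" "r \<in> qroots \<alpha> \<beta> m1" "s \<in> qroots \<alpha> \<beta> m2" by auto
      obtain x where x: "[x = r] (mod m1)" "[x = s] (mod m2)"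
        using binary_chinese_remainder_int[OF assms(3)] by blast
      define z where "z = x mod (m1 * m2)"
      have "z mod m1 = x mod m1" "z mod m2 = x mod m2" by (simp_all add: z_def mod_mod_cancel)
      then have z: "z mod m1 = r" "z mod m2 = s"
        using x y by (simp_all add: cong_def qroots_def)
      then have "m1 dvd \<alpha> * z\<^sup>2 + \<beta>" "m2 dvd \<alpha> * z\<^sup>2 + \<beta>"
        using y dvd_mod[of m1 z] dvd_mod[of m2 z] by (simp_all add: qroots_def)
      then have "m1 * m2 dvd \<alpha> * z\<^sup>2 + \<beta>" using assms(3) by (simp add: divides_mult)
      then have "z \<in> qroots \<alpha> \<beta> (m1 * m2)" using assms by (simp add: qroots_def z_def)
      moreover have "y = ?h z" using z y by simp
      ultimately show "y \<in> ?h ` qroots \<alpha> \<beta> (m1 * m2)" by (rule rev_image_eqI)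
    qed
  qed
  from bij_betw_same_card[OF this] show ?thesis by (simp add: card_cartesian_product)
qed

text \<open>Hensel lifting; the step from exponent 0 to 1 is the hypothesis that \<open>a\<close> is
  a residue.\<close>

lemma sqrt_mod_prime_power:
  fixes p a :: int
  assumes "prime p" "odd p" "\<not> p dvd a" "QuadRes p a"
  shows "\<exists>x. p ^ j dvd x\<^sup>2 - a"
proof (induction j)
  case (Suc j)
  show ?case
  proof (cases j)
    case 0
    then show ?thesis using assms(4) by (auto simp: QuadRes_def cong_iff_dvd_diff)
  next
    case (Suc i)
    obtain x t where t: "x\<^sup>2 - a = p ^ j * t" using Suc.IH by (auto elim: dvdE)
    have "p dvd x\<^sup>2 - a" unfolding t Suc by simp
    then have "\<not> p dvd x" using assms(3) by (metis dvd_diff_right_iff dvd_mult dvd_mult2 power2_eq_square dvd_diff_commute)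
    then have "coprime (2 * x) p" using assms(1,2)
      by (metis coprime_commute coprime_mult_left_iff coprime_left_2_iff_odd prime_imp_coprime)
    then obtain w where w: "[2 * x * w = 1] (mod p)" using cong_solve_coprime_int by blast
    \<comment> \<open>Newton's correction: \<open>w\<close> inverts \<open>2 * x\<close> modulo
      \<open>p\<close>, so this \<open>s\<close> cancels \<open>t\<close> to first order.\<close>
    define s where "s = - t * w"
    have "p dvd 2 * x * w - 1" using w by (simp add: cong_iff_dvd_diff)
    then have "p dvd (-t) * (2 * x * w - 1)" by (rule dvd_mult)
    then have *: "p dvd t + 2 * x * s" by (simp add: s_def algebra_simps)
    have "(x + p ^ j * s)\<^sup>2 - a = p ^ j * (t + 2 * x * s) + p ^ j * p ^ j * s\<^sup>2"
      using t by (simp add: power2_eq_square algebra_simps)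
    also have "p ^ Suc j dvd \<dots>"
    proof (rule dvd_add)
      show "p ^ Suc j dvd p ^ j * (t + 2 * x * s)" using * by (simp add: mult_dvd_mono mult.commute)
      have "p dvd p ^ j" using Suc by simp
      then have "p ^ j * p dvd p ^ j * p ^ j" by (rule mult_dvd_mono[OF dvd_refl])
      then show "p ^ Suc j dvd p ^ j * p ^ j * s\<^sup>2" by (simp add: mult.commute)
    qed
    finally show ?thesis by blast
  qed
qed simp

text \<open>Dividing a square root of -\<alpha>\<beta> by \<alpha> gives one root \<open>r\<close>.
  For any root \<open>s\<close>, the prime divides at most one of \<open>s - r\<close> and
  \<open>s + r\<close>, so \<open>p ^ j\<close> divides the other factor and \<open>s\<close> is
  \<open>r\<close> or \<open>- r\<close>. That the count is even shows that these two
  differ.\<close>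

lemma card_qroots_prime_power:
  fixes p \<alpha> \<beta> :: int
  assumes p: "prime p" "odd p" "\<not> p dvd \<alpha>" "\<not> p dvd \<beta>" and QR: "QuadRes p (- \<alpha> * \<beta>)" and "j > 0"
  shows "card (qroots \<alpha> \<beta> (p ^ j)) = 2"
proof -
  let ?m = "p ^ j"
  have "p > 1" using p prime_gt_1_int by blast
  then have m: "?m > 1" using \<open>j > 0\<close> by (simp add: one_less_power)
  have "p dvd ?m" using \<open>j > 0\<close> by simp
  have "\<not> p dvd - \<alpha> * \<beta>" using p by (simp add: prime_dvd_mult_iff)
  from sqrt_mod_prime_power[OF p(1,2) this QR]
  obtain x where x: "?m dvd x\<^sup>2 - (- \<alpha> * \<beta>)" by blast
  have cop: "coprime \<alpha> ?m" using p prime_imp_coprime coprime_commute by (metis coprime_power_right_iff)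
  then obtain w where w: "[\<alpha> * w = 1] (mod ?m)" using cong_solve_coprime_int by blast
  define r where "r = (x * w) mod ?m"
  have "[\<alpha> * r = \<alpha> * (x * w)] (mod ?m)" unfolding r_def by (intro cong_mult) (auto simp: cong_def)
  also have "\<alpha> * (x * w) = x * (\<alpha> * w)" by simp
  also have "[x * (\<alpha> * w) = x * 1] (mod ?m)" using w by (intro cong_mult) auto
  finally have "[(\<alpha> * r)\<^sup>2 = x\<^sup>2] (mod ?m)" by (intro cong_pow) simp
  then have "?m dvd ((\<alpha> * r)\<^sup>2 - x\<^sup>2) + (x\<^sup>2 - (- \<alpha> * \<beta>))"
    using x unfolding cong_iff_dvd_diff by (rule dvd_add)
  also have "\<dots> = \<alpha> * (\<alpha> * r\<^sup>2 + \<beta>)" by (simp add: power2_eq_square algebra_simps)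
  finally have "?m dvd \<alpha> * r\<^sup>2 + \<beta>" using cop by (simp add: coprime_commute coprime_dvd_mult_right_iff)
  then have r: "r \<in> qroots \<alpha> \<beta> ?m" using m by (simp add: qroots_def r_def)
  have ndvd: "\<not> p dvd s" if "s \<in> qroots \<alpha> \<beta> ?m" for s
  proof
    assume "p dvd s"
    then have "p dvd \<alpha> * s\<^sup>2" by (simp add: power2_eq_square)
    moreover have "p dvd \<alpha> * s\<^sup>2 + \<beta>" using that \<open>p dvd ?m\<close> by (auto simp: qroots_def intro: dvd_trans)
    ultimately show False using p(4) by (simp add: dvd_add_right_iff)
  qed
  have "s = r \<or> s = (- r) mod ?m" if s: "s \<in> qroots \<alpha> \<beta> ?m" for s
  proof -
    have "?m dvd (\<alpha> * s\<^sup>2 + \<beta>) - (\<alpha> * r\<^sup>2 + \<beta>)"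
      using s r by (intro dvd_diff) (auto simp: qroots_def)
    also have "\<dots> = \<alpha> * ((s - r) * (s + r))" by (simp add: power2_eq_square algebra_simps)
    finally have d: "?m dvd (s - r) * (s + r)" using cop by (simp add: coprime_commute coprime_dvd_mult_right_iff)
    have "\<not> (p dvd s - r \<and> p dvd s + r)"
    proof
      assume "p dvd s - r \<and> p dvd s + r"
      then have "p dvd (s - r) + (s + r)" using dvd_add by blast
      then have "p dvd 2 * s" by simp
      then have "p dvd s" using p(2) coprime_dvd_mult_right_iff coprime_right_2_iff_odd by blast
      then show False using ndvd[OF s] by simp
    qed
    then have "coprime ?m (s - r) \<or> coprime ?m (s + r)"
      using p(1) by (auto simp: coprime_power_left_iff intro: prime_imp_coprime)
    then have "?m dvd s - r \<or> ?m dvd s - (- r)" using d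
      by (auto simp: coprime_dvd_mult_left_iff coprime_dvd_mult_right_iff)
    then have "s mod ?m = r mod ?m \<or> s mod ?m = (- r) mod ?m" by (simp only: mod_eq_dvd_iff)
    then show ?thesis using s r by (auto simp: qroots_def)
  qed
  then have "qroots \<alpha> \<beta> ?m = {r, (- r) mod ?m}" using r qroots_minus[OF r] m by auto
  then have "card (qroots \<alpha> \<beta> ?m) \<le> 2" by (simp add: card_insert_if)
  moreover have "even (card (qroots \<alpha> \<beta> ?m))"
    using m p by (intro even_card_qroots) (auto intro: prime_imp_coprime simp: coprime_power_left_iff)
  moreover have "card (qroots \<alpha> \<beta> ?m) \<noteq> 0" using r finite_qroots by auto
  ultimately show ?thesis by (elim evenE) auto
qed

section \<open>Parity of the numbers of representations\<close>

text \<open>Every representation is \<open>g\<close> times a primitive one, where \<open>g\<close>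
  is the gcd; \<open>sqf\<close> ensures that g^2 divides \<open>n\<close> itself and not merely
  \<gamma> n.\<close>

lemma card_reps_sum:
  fixes \<alpha> \<beta> \<gamma> n :: int
  assumes "\<alpha> > 0" "\<beta> > 0" "n > 0" and sqf: "\<And>g. g\<^sup>2 dvd \<gamma> * n \<Longrightarrow> g\<^sup>2 dvd n"
  shows "card (reps \<alpha> \<beta> (\<gamma> * n)) = (\<Sum>g | g > 0 \<and> g\<^sup>2 dvd n. card (prim_reps \<alpha> \<beta> (\<gamma> * (n div g\<^sup>2))))"
proof -
  let ?G = "{g. g > 0 \<and> g\<^sup>2 dvd n}"
  have "?G \<subseteq> {0..n}"
  proof
    fix g assume g: "g \<in> ?G"
    then have "g dvd n" by (metis dvd_trans dvd_triv_left mem_Collect_eq power2_eq_square)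
    then show "g \<in> {0..n}" using g assms(3) by (auto dest: zdvd_imp_le)
  qed
  then have fin: "finite ?G" by (rule finite_subset) simp
  have "bij_betw (\<lambda>(g, (u, v)). (g * u, g * v)) (SIGMA g:?G. prim_reps \<alpha> \<beta> (\<gamma> * (n div g\<^sup>2))) (reps \<alpha> \<beta> (\<gamma> * n))"
  proof (rule bij_betw_byWitness[where f' = "\<lambda>(u, v). (gcd u v, (u div gcd u v, v div gcd u v))"])
    show "\<forall>x\<in>(SIGMA g:?G. prim_reps \<alpha> \<beta> (\<gamma> * (n div g\<^sup>2))).
        (case case x of (g, u, v) \<Rightarrow> (g * u, g * v) of (u, v) \<Rightarrow> (gcd u v, u div gcd u v, v div gcd u v)) = x"
      by (auto simp: prim_reps_def gcd_mult_left coprime_iff_gcd_eq_1)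
    show "\<forall>x\<in>reps \<alpha> \<beta> (\<gamma> * n). (case case x of (u, v) \<Rightarrow> (gcd u v, u div gcd u v, v div gcd u v) of (g, u, v) \<Rightarrow> (g * u, g * v)) = x"
      by auto
    show "(\<lambda>(g, u, v). (g * u, g * v)) ` (SIGMA g:?G. prim_reps \<alpha> \<beta> (\<gamma> * (n div g\<^sup>2))) \<subseteq> reps \<alpha> \<beta> (\<gamma> * n)"
    proof (clarsimp simp: prim_reps_def reps_def)
      fix g u v assume *: "0 < g" "g\<^sup>2 dvd n" "\<alpha> * u\<^sup>2 + \<beta> * v\<^sup>2 = \<gamma> * (n div g\<^sup>2)"
      have "\<alpha> * (g * u)\<^sup>2 + \<beta> * (g * v)\<^sup>2 = g\<^sup>2 * (\<alpha> * u\<^sup>2 + \<beta> * v\<^sup>2)"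
        by (simp add: power2_eq_square algebra_simps)
      also have "\<dots> = \<gamma> * n" unfolding *(3) using *(2) by (metis dvd_mult_div_cancel mult.left_commute)
      finally show "\<alpha> * (g * u)\<^sup>2 + \<beta> * (g * v)\<^sup>2 = \<gamma> * n" .
    qed
    show "(\<lambda>(u, v). (gcd u v, u div gcd u v, v div gcd u v)) ` reps \<alpha> \<beta> (\<gamma> * n)
      \<subseteq> (SIGMA g:?G. prim_reps \<alpha> \<beta> (\<gamma> * (n div g\<^sup>2)))"
    proof (clarsimp simp: reps_def)
      fix u v :: int assume *: "0 < u" "0 < v" "\<alpha> * u\<^sup>2 + \<beta> * v\<^sup>2 = \<gamma> * n"
      define g where "g = gcd u v"
      have "g > 0" using * by (simp add: g_def)
      obtain a b where ab: "u = g * a" "v = g * b" unfolding g_def by (meson dvdE gcd_dvd1 gcd_dvd2)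
      have gn: "g\<^sup>2 * (\<alpha> * a\<^sup>2 + \<beta> * b\<^sup>2) = \<gamma> * n"
        using *(3) unfolding ab by (simp add: power2_eq_square algebra_simps)
      then have gd: "g\<^sup>2 dvd n" using sqf by (metis dvd_triv_left)
      then obtain n' where n': "n = g\<^sup>2 * n'" by (elim dvdE)
      have pos: "0 < a" "0 < b" using * \<open>g > 0\<close> unfolding ab by (simp_all add: zero_less_mult_iff)
      have "\<alpha> * a\<^sup>2 + \<beta> * b\<^sup>2 = \<gamma> * (n div g\<^sup>2)" using gn \<open>g > 0\<close> unfolding n' by (simp add: mult.left_commute)
      moreover have "coprime a b"
      proof -
        have "g = g * gcd a b" using \<open>g > 0\<close> by (metis ab g_def gcd_mult_left abs_of_pos gcd_mult_distrib_int)
        then show ?thesis using \<open>g > 0\<close> by (simp add: coprime_iff_gcd_eq_1)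
      qed
      moreover have "u div g = a" "v div g = b" using \<open>g > 0\<close> unfolding ab by simp_all
      ultimately show "(gcd u v)\<^sup>2 dvd n \<and> (u div gcd u v, v div gcd u v) \<in> prim_reps \<alpha> \<beta> (\<gamma> * (n div (gcd u v)\<^sup>2))"
        using gd pos unfolding g_def[symmetric] by (simp add: prim_reps_def reps_def)
    qed
  qed
  then have "card (reps \<alpha> \<beta> (\<gamma> * n)) = card (SIGMA g:?G. prim_reps \<alpha> \<beta> (\<gamma> * (n div g\<^sup>2)))"
    by (simp add: bij_betw_same_card)
  also have "\<dots> = (\<Sum>g\<in>?G. card (prim_reps \<alpha> \<beta> (\<gamma> * (n div g\<^sup>2))))"
  proof (rule card_SigmaI[OF fin])
    show "\<forall>g\<in>?G. finite (prim_reps \<alpha> \<beta> (\<gamma> * (n div g\<^sup>2)))"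
      using finite_reps[OF assms(1,2)] by (auto simp: prim_reps_def intro: finite_subset[OF _ finite_reps[OF assms(1,2)]])
  qed
  finally show ?thesis .
qed

text \<open>The square of \<open>g\<close> is a unit modulo 3, 4 and 7. It is 1 modulo 12 and a
  quadratic residue modulo 7, so multiplication by it preserves the class 5 and the set 3, 5, 6 of
  non-residues.\<close>

lemma residue_class_div_square:
  fixes m g :: int
  assumes "(m * g\<^sup>2) mod 12 = 5" "(m * g\<^sup>2) mod 7 \<in> {3, 5, 6}"
  shows "m mod 12 = 5 \<and> m mod 7 \<in> {3, 5, 6}"
proof -
  have e: "((m mod n) * (g\<^sup>2 mod n)) mod n = (m * g\<^sup>2) mod n" for n by (rule mod_mult_eq)
  have 0: "(m * g\<^sup>2) mod 3 = 2" "(m * g\<^sup>2) mod 4 = 1" using assms(1) by presburger+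
  have "m mod 3 = 2" using e[of 3] mod_square_cases(1)[of g] unfolding 0 by (elim insertE emptyE) simp_all
  moreover have "m mod 4 = 1" using e[of 4] mod_square_cases(2)[of g] unfolding 0 by (elim insertE emptyE) simp_all
  ultimately have "m mod 12 = 5" by presburger
  moreover have "x \<in> {3, 5, 6}" if "x \<in> {0, 1, 2, 3, 4, 5, 6}" "y \<in> {0, 1, 2, 4}" "(x * y) mod 7 \<in> {3, 5, 6}" for x y :: int
    using that by (elim insertE[of x] insertE[of y] emptyE) simp_all
  moreover have "m mod 7 \<in> {0, 1, 2, 3, 4, 5, 6}" by simp presburger
  ultimately show ?thesis using e[of 7] mod_square_cases(3)[of g] assms(2) by metis
qed

lemma Legendre_eq_minus_1:
  assumes "\<And>y. (y\<^sup>2 - a) mod p \<noteq> 0" "a mod p \<noteq> 0"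
  shows "Legendre a p = -1"
  using assms by (simp add: Legendre_def QuadRes_def cong_iff_dvd_diff dvd_eq_mod_eq_0)

text \<open>As \<open>p\<close> is 1 modulo 4, -1 is a square and reciprocity has no sign: 3 and 7
  are non-residues modulo \<open>p\<close> because \<open>p\<close> is a non-residue modulo 3 and
  modulo 7. Hence the product of -1, 3 and 7 is a residue.\<close>

lemma QuadRes_minus_4_minus_21:
  fixes p :: int
  assumes p: "prime p" "p mod 12 = 5" "p mod 7 \<in> {3, 5, 6}"
  shows "QuadRes p (- 4)" "QuadRes p (- 21)"
proof -
  define q where "q = nat p"
  have q: "p = int q" using p(1) prime_gt_0_int[of p] by (simp add: q_def)
  have "prime q" using p(1) unfolding q by simp
  have "p > 2" using p(1,2) prime_gt_1_int[of p] by (cases "p = 2") auto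
  then have "q > 2" using q by simp
  define h where "h = (q - 1) div 2"
  have "even h"
  proof -
    have "p mod 4 = 1" using p(2) by presburger
    then have "q mod 4 = 1" using q by presburger
    then show ?thesis unfolding h_def by presburger
  qed
  \<comment> \<open>Euler's criterion gives a congruence; for p > 2 the possible values 0, 1, -1 of
    the symbol are distinct modulo \<open>p\<close>.\<close>
  have QR: "QuadRes p a" if "[a ^ h = 1] (mod p)" for a
  proof -
    have "[Legendre a p = 1] (mod p)"
      using cong_trans[OF euler_criterion[OF \<open>prime q\<close> \<open>q > 2\<close>, of a]] that unfolding q h_def by blast
    then have "p dvd Legendre a p - 1" by (simp add: cong_iff_dvd_diff)
    moreover have "Legendre a p \<in> {0, 1, - 1}" by (simp add: Legendre_def)
    moreover have "\<not> p dvd 1" "\<not> p dvd 2" using \<open>p > 2\<close> by (auto dest: zdvd_imp_le)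
    ultimately have "Legendre a p = 1" by (elim insertE emptyE) simp_all
    then show ?thesis by (simp add: Legendre_def split: if_splits)
  qed
  have "QuadRes p (- 1)" using \<open>even h\<close> by (intro QR) simp
  then obtain y where "[y\<^sup>2 = - 1] (mod p)" by (auto simp: QuadRes_def)
  from cong_scalar_left[OF this, of 4] have "[(2 * y)\<^sup>2 = - 4] (mod p)" by (simp add: power_mult_distrib)
  then show "QuadRes p (- 4)" unfolding QuadRes_def by blast
  have "(y\<^sup>2 - p) mod 3 \<noteq> 0" for y
  proof
    assume "(y\<^sup>2 - p) mod 3 = 0"
    then have "y\<^sup>2 mod 3 = p mod 3" by (simp add: mod_eq_dvd_iff dvd_eq_mod_eq_0)
    also have "p mod 3 = 2" using p(2) by presburger
    finally show False using mod_square_cases(1)[of y] by simp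
  qed
  moreover have "p mod 3 \<noteq> 0" using p(2) by presburger
  ultimately have "Legendre p 3 = -1" by (rule Legendre_eq_minus_1)
  moreover have "Legendre 3 p * Legendre p 3 = 1"
  proof -
    have "q \<noteq> 3" using p(2) q by auto
    then show ?thesis
      using Quadratic_Reciprocity[of 3 q] \<open>prime q\<close> \<open>q > 2\<close> \<open>even h\<close> by (simp add: q h_def)
  qed
  ultimately have L3: "Legendre 3 p = -1" by simp
  have "(y\<^sup>2 - p) mod 7 \<noteq> 0" for y
  proof
    assume "(y\<^sup>2 - p) mod 7 = 0"
    then have "y\<^sup>2 mod 7 = p mod 7" by (simp add: mod_eq_dvd_iff dvd_eq_mod_eq_0)
    then show False using mod_square_cases(3)[of y] p(3) by auto
  qed
  moreover have "p mod 7 \<noteq> 0" using p(3) by auto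
  ultimately have "Legendre p 7 = -1" by (rule Legendre_eq_minus_1)
  moreover have "Legendre 7 p * Legendre p 7 = 1"
  proof -
    have "q \<noteq> 7" using p(3) q by auto
    then show ?thesis
      using Quadratic_Reciprocity[of 7 q] \<open>prime q\<close> \<open>q > 2\<close> \<open>even h\<close> by (simp add: q h_def power_mult)
  qed
  ultimately have L7: "Legendre 7 p = -1" by simp
  have E: "[a ^ h = Legendre a p] (mod p)" for a
    using euler_criterion[OF \<open>prime q\<close> \<open>q > 2\<close>, of a] unfolding q h_def by (rule cong_sym)
  have "(- 21 :: int) ^ h = (-1) ^ h * (3 ^ h * 7 ^ h)"
    by (simp flip: power_mult_distrib)
  also have "[\<dots> = 1 * (- 1 * - 1)] (mod p)"
    using E[of 3] E[of 7] \<open>even h\<close> unfolding L3 L7 by (intro cong_mult) auto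
  finally show "QuadRes p (- 21)" by (intro QR) simp
qed

text \<open>Twice each count is a number of roots modulo \<open>m\<close>. If \<open>m\<close>
  splits into two coprime factors above 1, each number of roots is a product of two even numbers, so
  both counts are even. If \<open>m\<close> is a prime power, both counts are 1.\<close>

lemma even_card_prim_reps_iff:
  fixes m :: int
  assumes m: "m > 0" "m mod 12 = 5" "m mod 7 \<in> {3, 5, 6}"
  shows "even (card (prim_reps 1 4 m)) \<longleftrightarrow> even (card (prim_reps 3 7 (2 * m)))"
proof -
  have "m \<noteq> 1" using m(2) by auto
  then have "m > 1" using m(1) by simp
  have "odd m" "\<not> 3 dvd m" using m(2) by presburger+
  have "\<not> 7 dvd m" using m(3) by auto
  have "coprime 3 m" "coprime 7 m"
    using \<open>\<not> 3 dvd m\<close> \<open>\<not> 7 dvd m\<close> by (simp_all add: prime_imp_coprime)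
  moreover have "coprime (2 * 2) m"
    using \<open>odd m\<close> unfolding coprime_mult_left_iff by simp
  ultimately have cop: "coprime m 3" "coprime m 7" "coprime m 4" by (simp_all add: coprime_commute)
  have m4: "m mod 4 = 1" using m(2) by presburger
  have "card (qroots 1 4 m) = 2 * card (prim_reps 1 4 (1 * m))"
    by (rule card_qroots[OF _ _ _ \<open>m > 1\<close> _ cop(3) \<open>odd m\<close> _ ex_rep_1_4[OF m(1) m4]]) simp_all
  then have c4: "card (qroots 1 4 m) = 2 * card (prim_reps 1 4 m)" by simp
  have c7: "card (qroots 3 7 m) = 2 * card (prim_reps 3 7 (2 * m))"
    by (rule card_qroots[OF _ _ _ \<open>m > 1\<close> cop(1,2) \<open>odd m\<close> _ ex_rep_3_7[OF m]]) simp_all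
  obtain p where p: "prime p" "p dvd m" using \<open>m > 1\<close> prime_divisor_exists[of m] by auto
  have "p > 1" using p(1) prime_gt_1_int by blast
  obtain y where y: "m = p ^ multiplicity p m * y" "\<not> p dvd y"
    using multiplicity_decompose'[of m p] m(1) p(1) by (metis less_irrefl not_prime_unit)
  define j where "j = multiplicity p m"
  have "j > 0" using p m(1) \<open>p > 1\<close> by (simp add: j_def multiplicity_gt_zero_iff)
  have my: "m = p ^ j * y" using y by (simp add: j_def)
  have "y > 0" using m(1) \<open>p > 1\<close> unfolding my by (simp add: zero_less_mult_iff)
  have np: "odd p" "\<not> p dvd 4" "\<not> p dvd 3" "\<not> p dvd 7" "\<not> p dvd 1"
    using cop p \<open>odd m\<close> by (meson coprime_common_divisor dvd_trans not_prime_unit)+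
  show ?thesis
  proof (cases "y = 1")
    case True
    \<comment> \<open>A square is never 2 modulo 3. With odd \<open>j\<close>, \<open>m\<close> is
      \<open>p\<close> times a square, so \<open>p\<close> inherits the residue classes of
      \<open>m\<close>.\<close>
    have "odd j"
    proof
      assume "even j"
      then obtain i where "j = 2 * i" by (elim evenE)
      then have "m = (p ^ i)\<^sup>2" using my True by (simp add: power_mult[symmetric] mult.commute)
      moreover have "m mod 3 = 2" using m(2) by presburger
      ultimately show False using mod_square_cases(1)[of "p ^ i"] by simp
    qed
    then obtain i where "j = 2 * i + 1" by (elim oddE)
    then have "m = p * (p ^ i)\<^sup>2" using my True by (simp add: power_mult[symmetric] mult.commute)
    then have "p mod 12 = 5 \<and> p mod 7 \<in> {3, 5, 6}"
      using residue_class_div_square[of p "p ^ i"] m by simp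
    then have "QuadRes p (- 4)" "QuadRes p (- 21)" using QuadRes_minus_4_minus_21 p(1) by blast+
    then have "card (qroots 1 4 m) = 2" "card (qroots 3 7 m) = 2"
      using card_qroots_prime_power[of p 1 4 j] card_qroots_prime_power[of p 3 7 j] p np \<open>j > 0\<close>
      unfolding my True by simp_all
    then show ?thesis using c4 c7 by simp
  next
    case False
    then have "y > 1" using \<open>y > 0\<close> by simp
    have cj: "coprime (p ^ j) y" using p(1) y(2) by (simp add: prime_imp_coprime)
    have pj: "p ^ j > 1" using \<open>p > 1\<close> \<open>j > 0\<close> by (simp add: one_less_power)
    have "even (card (qroots \<alpha> \<beta> m) div 2)" if "coprime m \<beta>" for \<alpha> \<beta>
    proof -
      have "odd (p ^ j)" "odd y" "coprime (p ^ j) \<beta>" "coprime y \<beta>"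
        using \<open>odd m\<close> that unfolding my by auto
      then have "even (card (qroots \<alpha> \<beta> (p ^ j)))" "even (card (qroots \<alpha> \<beta> y))"
        using pj \<open>y > 1\<close> by (simp_all add: even_card_qroots)
      then show ?thesis using card_qroots_mult[OF _ \<open>y > 0\<close> cj, of \<alpha> \<beta>] pj unfolding my
        by (auto elim!: evenE)
    qed
    from this[OF cop(3), of 1] this[OF cop(2), of 3] show ?thesis using c4 c7 by simp
  qed
qed

text \<open>Sorting by the gcd reduces this to \<open>even_card_prim_reps_iff\<close> for each
  quotient of \<open>n\<close> by a square, which satisfies the same congruence conditions as
  \<open>n\<close>.\<close>

lemma even_card_reps_iff:
  fixes n :: int
  assumes n: "n > 0" "n mod 12 = 5" "n mod 7 \<in> {3, 5, 6}"
  shows "even (card (reps 1 4 n)) \<longleftrightarrow> even (card (reps 3 7 (2 * n)))"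
proof -
  let ?G = "{g. g > 0 \<and> g\<^sup>2 dvd n}"
  have "odd n" using n(2) by presburger
  have c4: "card (reps 1 4 n) = (\<Sum>g\<in>?G. card (prim_reps 1 4 (n div g\<^sup>2)))"
    using card_reps_sum[of 1 4 n 1] n(1) by simp
  have c7: "card (reps 3 7 (2 * n)) = (\<Sum>g\<in>?G. card (prim_reps 3 7 (2 * (n div g\<^sup>2))))"
    using card_reps_sum[of 3 7 n 2] n(1) square_dvd_double[OF \<open>odd n\<close>] by simp
  have "[card (reps 1 4 n) = card (reps 3 7 (2 * n))] (mod 2)"
    unfolding c4 c7
  proof (rule cong_sum)
    fix g assume "g \<in> ?G"
    then have g: "n = (n div g\<^sup>2) * g\<^sup>2" "g > 0" by simp_all
    then have "n div g\<^sup>2 > 0" using n(1) by (metis zero_less_mult_pos2 zero_less_power)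
    moreover have "n div g\<^sup>2 mod 12 = 5 \<and> n div g\<^sup>2 mod 7 \<in> {3, 5, 6}"
      using residue_class_div_square[of "n div g\<^sup>2" g] n g(1) by metis
    ultimately show "[card (prim_reps 1 4 (n div g\<^sup>2)) = card (prim_reps 3 7 (2 * (n div g\<^sup>2)))] (mod 2)"
      using even_card_prim_reps_iff[of "n div g\<^sup>2"] by (simp add: cong_def mod2_eq_if)
  qed
  then show ?thesis by (simp add: cong_def mod2_eq_if split: if_splits)
qed

section \<open>Two ternary forms\<close>

lemma seven_dvd_square_iff:
  fixes x :: int
  shows "7 dvd x\<^sup>2 \<longleftrightarrow> 7 dvd x"
  by (rule prime_dvd_power_iff) simp_all

text \<open>-4 is a quadratic non-residue modulo 7.\<close>

lemma seven_dvd_norm: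
  fixes x y :: int
  assumes "7 dvd x\<^sup>2 + 4 * y\<^sup>2"
  shows "7 dvd x \<and> 7 dvd y"
proof -
  have "(x\<^sup>2 mod 7 + 4 * (y\<^sup>2 mod 7)) mod 7 = (x\<^sup>2 + 4 * y\<^sup>2) mod 7"
    by (rule mod_add_cong[OF mod_mod_trivial mod_mult_right_eq])
  then have "(x\<^sup>2 mod 7 + 4 * (y\<^sup>2 mod 7)) mod 7 = 0" using assms by simp
  then have "x\<^sup>2 mod 7 = 0 \<and> y\<^sup>2 mod 7 = 0"
    using mod_square_cases(3)[of x] mod_square_cases(3)[of y]
    by (elim insertE[of "x\<^sup>2 mod 7"] insertE[of "y\<^sup>2 mod 7"] emptyE) simp_all
  then show ?thesis using seven_dvd_square_iff by (simp add: dvd_eq_mod_eq_0)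
qed

text \<open>Since 72 = 84 - 12, the equation gives u^2 = 4z^2 modulo 7, so 7 divides
  \<open>u - 2 * z\<close> or \<open>u + 2 * z\<close>. If 7 divided both, it would divide
  \<open>u\<close> and \<open>z\<close>, and dividing the equation by 7 would make the non-residue
  2k a square modulo 7.\<close>

lemma seven_dvd_3_7_72:
  fixes u v z k :: int
  assumes k: "k mod 7 \<in> {3, 5, 6}" and eq: "3 * u\<^sup>2 + 7 * v\<^sup>2 + 72 * z\<^sup>2 = 14 * k"
  shows "\<not> 7 dvd z" "\<not> 7 dvd u" "7 dvd u - 2 * z \<longleftrightarrow> \<not> 7 dvd u + 2 * z"
proof -
  have *: "3 * (u\<^sup>2 - 4 * z\<^sup>2) = 7 * (2 * k - v\<^sup>2 - 12 * z\<^sup>2)" using eq by simp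
  have "7 dvd 3 * (u\<^sup>2 - 4 * z\<^sup>2)" unfolding * by simp
  moreover have "\<not> 7 dvd (3 :: int)" "prime (7 :: int)" by simp_all
  ultimately have d: "7 dvd u\<^sup>2 - 2\<^sup>2 * z\<^sup>2" using prime_dvd_mult_iff[of 7 3 "u\<^sup>2 - 4 * z\<^sup>2"] by simp
  also have "u\<^sup>2 - 2\<^sup>2 * z\<^sup>2 = (u - 2 * z) * (u + 2 * z)" by (simp add: power2_eq_square algebra_simps)
  finally have or: "7 dvd u - 2 * z \<or> 7 dvd u + 2 * z" using \<open>prime 7\<close> prime_dvd_mult_iff by blast
  have not_both: "\<not> (7 dvd u \<and> 7 dvd z)"
  proof
    assume "7 dvd u \<and> 7 dvd z"
    then obtain a b where ab: "u = 7 * a" "z = 7 * b" by (auto elim!: dvdE)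
    have "v\<^sup>2 = 2 * k + 7 * (- 3 * a\<^sup>2 - 72 * b\<^sup>2)" using eq unfolding ab by (simp add: power_mult_distrib)
    then have "v\<^sup>2 mod 7 = (2 * k) mod 7" by (simp only: mod_mult_self2)
    also have "\<dots> = (2 * (k mod 7)) mod 7" by (rule mod_mult_right_eq[symmetric])
    finally show False using k mod_square_cases(3)[of v] by auto
  qed
  have z2: "7 dvd z \<longleftrightarrow> 7 dvd 2 * z"
    using prime_dvd_mult_iff[OF \<open>prime 7\<close>, of 2 z] by auto
  have uz: "7 dvd u \<longleftrightarrow> 7 dvd z"
    using or z2 dvd_add_left_iff[of 7 "2 * z" u] dvd_diff_left_iff[of 7 "2 * z" u]
      dvd_diff_right_iff[of 7 u "2 * z"] dvd_add_right_iff[of 7 u "2 * z"]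
    by blast
  then show nz: "\<not> 7 dvd z" and "\<not> 7 dvd u" using not_both by blast+
  have "\<not> (7 dvd u - 2 * z \<and> 7 dvd u + 2 * z)"
  proof
    assume "7 dvd u - 2 * z \<and> 7 dvd u + 2 * z"
    then have "7 dvd (u + 2 * z) - (u - 2 * z)" using dvd_diff by blast
    then have "7 dvd 2 * (2 * z)" by simp
    then show False using nz z2 prime_dvd_mult_iff[OF \<open>prime 7\<close>, of 2 "2 * z"] by auto
  qed
  then show "7 dvd u - 2 * z \<longleftrightarrow> \<not> 7 dvd u + 2 * z" using or by blast
qed

text \<open>The involution multiplies \<open>u + 2 z \<surd>-6\<close> by one of the two elements
  \<open>(5 \<plusminus> 2 \<surd>-6) / 7\<close> of norm 1, the one for which the product is integral.\<close>
lemma even_card_3_7_72: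
  fixes k :: int
  assumes k: "odd k" "k mod 7 \<in> {3, 5, 6}"
  shows "even (card {(z, u, v). z > 0 \<and> u > 0 \<and> v > 0 \<and> 3 * u\<^sup>2 + 7 * v\<^sup>2 + 72 * z\<^sup>2 = 14 * k})"
    (is "even (card ?Q)")
proof -
  \<comment> \<open>\<open>t z u\<close> is the sign for which 7 divides
    \<open>u - 2 * t z u * z\<close>, and this makes both quotients in \<open>h\<close>
    exact.\<close>
  define t where "t z u = (if 7 dvd u - 2 * z then 1 else - 1 :: int)" for z u :: int
  define h where "h = (\<lambda>(z, u, v :: int). (\<bar>5 * z + t z u * u\<bar> div 7, \<bar>5 * u - 24 * t z u * z\<bar> div 7, v))"
  have t_unique: "t z u = s"
    if "3 * u\<^sup>2 + 7 * v\<^sup>2 + 72 * z\<^sup>2 = 14 * k" "7 dvd u - 2 * s * z" "s \<in> {1, - 1}" for z u v s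
    using seven_dvd_3_7_72(3)[OF k(2) that(1)] that(2,3) by (auto simp: t_def)
  have step: "\<exists>z' u'. 7 * z' = 5 * z + t z u * u \<and> 7 * u' = 5 * u - 24 * t z u * z \<and> h (z, u, v) = (\<bar>z'\<bar>, \<bar>u'\<bar>, v) \<and>
      3 * u'\<^sup>2 + 7 * v\<^sup>2 + 72 * z'\<^sup>2 = 14 * k"
    if eq: "3 * u\<^sup>2 + 7 * v\<^sup>2 + 72 * z\<^sup>2 = 14 * k" for z u v
  proof -
    have abs_div: "\<bar>7 * x\<bar> div 7 = \<bar>x\<bar>" for x :: int by (simp add: abs_mult)
    have tt: "t z u * t z u = 1" by (simp add: t_def)
    have "7 dvd u - 2 * (t z u * z)" using seven_dvd_3_7_72(3)[OF k(2) eq] by (auto simp: t_def)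
    then obtain w where w: "u = 7 * w + 2 * (t z u * z)" by (metis diff_eq_eq dvdE)
    define s where "s = t z u"
    have ss: "s * s = 1" using tt by (simp add: s_def)
    have w: "u = 7 * w + 2 * (s * z)" using w unfolding s_def .
    have z': "7 * (s * w + z) = 5 * z + s * u"
      unfolding w using ss by (simp add: algebra_simps)
    have u': "7 * (5 * w - 2 * (s * z)) = 5 * u - 24 * s * z"
      unfolding w by (simp add: algebra_simps)
    have "h (z, u, v) = (\<bar>7 * (s * w + z)\<bar> div 7, \<bar>7 * (5 * w - 2 * (s * z))\<bar> div 7, v)"
      unfolding z' u' by (simp add: h_def s_def)
    then have h: "h (z, u, v) = (\<bar>s * w + z\<bar>, \<bar>5 * w - 2 * (s * z)\<bar>, v)" unfolding abs_div .
    have "(5 * w - 2 * (s * z))\<^sup>2 + 24 * (s * w + z)\<^sup>2 = (25 + 24 * (s * s)) * w\<^sup>2 + 28 * (w * (s * z)) + (4 * (s * s) + 24) * z\<^sup>2"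
      by (simp add: power2_eq_square algebra_simps)
    also have "\<dots> = (7 * w + 2 * (s * z))\<^sup>2 + (28 - 4 * (s * s)) * z\<^sup>2"
      unfolding ss by (simp add: power2_eq_square algebra_simps) (simp add: ss flip: mult.assoc)
    also have "\<dots> = u\<^sup>2 + 24 * z\<^sup>2" unfolding w[symmetric] ss by simp
    finally have "3 * (5 * w - 2 * (s * z))\<^sup>2 + 7 * v\<^sup>2 + 72 * (s * w + z)\<^sup>2 = 14 * k" using eq by simp
    then show ?thesis using z' u' h unfolding s_def by blast
  qed
  show ?thesis
  proof (rule even_card_involution[where h = h])
    fix x assume "x \<in> ?Q"
    then obtain z u v where x: "x = (z, u, v)" and pos: "z > 0" "u > 0" "v > 0"
      and eq: "3 * u\<^sup>2 + 7 * v\<^sup>2 + 72 * z\<^sup>2 = 14 * k" by auto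
    obtain z' u' where z': "7 * z' = 5 * z + t z u * u" and u': "7 * u' = 5 * u - 24 * t z u * z"
      and h: "h x = (\<bar>z'\<bar>, \<bar>u'\<bar>, v)" and eq': "3 * u'\<^sup>2 + 7 * v\<^sup>2 + 72 * z'\<^sup>2 = 14 * k"
      using step[OF eq] unfolding x by blast
    have nz: "z' \<noteq> 0" "u' \<noteq> 0" using seven_dvd_3_7_72(1,2)[OF k(2) eq'] by auto
    then show "h x \<in> ?Q" using pos eq' unfolding h by simp
    define s where "s = t z u"
    have s: "s = 1 \<or> s = - 1" by (simp add: s_def t_def)
    \<comment> \<open>The sign selected at the image point. The absolute values in \<open>h\<close>
      may flip signs, hence the factors \<open>sgn\<close>; up to these, the second application of
      \<open>h\<close> multiplies by the conjugate element.\<close>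
    define r where "r = - s * sgn z' * sgn u'"
    have r: "r \<in> {1, - 1}" using s nz by (auto simp: r_def sgn_if)
    have undo: "7 * z = 5 * z' - s * u'" "7 * u = 5 * u' + 24 * s * z'"
      using z' u' s unfolding s_def[symmetric] by auto
    have eq2: "3 * \<bar>u'\<bar>\<^sup>2 + 7 * v\<^sup>2 + 72 * \<bar>z'\<bar>\<^sup>2 = 14 * k" using eq' by simp
    have "7 dvd \<bar>u'\<bar> - 2 * r * \<bar>z'\<bar>"
    proof
      show "\<bar>u'\<bar> - 2 * r * \<bar>z'\<bar> = 7 * (sgn u' * s * (z' - z))"
        using undo s nz by (auto simp: r_def sgn_if abs_if)
    qed
    then have tr: "t \<bar>z'\<bar> \<bar>u'\<bar> = r" using t_unique[OF eq2] r by blast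
    have "\<bar>5 * \<bar>z'\<bar> + r * \<bar>u'\<bar>\<bar> = 7 * z" "\<bar>5 * \<bar>u'\<bar> - 24 * r * \<bar>z'\<bar>\<bar> = 7 * u"
      using undo s nz pos by (auto simp: r_def sgn_if abs_if split: if_splits)
    then show "h (h x) = x" unfolding h by (simp add: h_def tr x)
    show "h x \<noteq> x"
    proof
      assume "h x = x"
      then have "\<bar>z'\<bar> = z" using h x by simp
      then have "z' = z \<or> z' = - z" by auto
      \<comment> \<open>At a fixed point \<open>5 * z + s * u\<close> is \<open>7 * z\<close> or
        \<open>- 7 * z\<close>, so \<open>u\<close> is even. Then \<open>v\<close> is even too, and
        halving the equation contradicts odd \<open>k\<close>.\<close>
      then have "u = 2 * z \<or> u = 12 * z" using z' s pos unfolding s_def[symmetric] by auto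
      then have "even u" by auto
      have "7 * v\<^sup>2 = 2 * (7 * k - 36 * z\<^sup>2) - 3 * u\<^sup>2" using eq by simp
      also have "even \<dots>" using \<open>even u\<close> by simp
      finally have "even (7 * v\<^sup>2)" .
      then have "even v" by simp
      with \<open>even u\<close> obtain a b where "u = 2 * a" "v = 2 * b" by (auto elim!: evenE)
      then have "7 * k = 2 * (3 * a\<^sup>2 + 7 * b\<^sup>2 + 18 * z\<^sup>2)" using eq by (simp add: power_mult_distrib)
      then have "even (7 * k)" by simp
      then show False using k(1) by simp
    qed
  qed
qed

text \<open>Both solution sets are fibred over \<open>z\<close>, with n = 7k - 36z^2 in the fibre.
  If 7 divides \<open>z\<close>, both fibres are empty. Otherwise \<open>n\<close> is 5 modulo 12
  and is -z^2 modulo 7, a non-residue, so the fibres have equal parity. The total for the second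
  form is even by \<open>even_card_3_7_72\<close>.\<close>

lemma even_card_1_4_36:
  fixes k :: int
  assumes k: "k mod 12 = 11" "k mod 7 \<in> {3, 5, 6}"
  shows "even (card {(z, x, y). z > 0 \<and> x > 0 \<and> y > 0 \<and> x\<^sup>2 + 4 * y\<^sup>2 + 36 * z\<^sup>2 = 7 * k})"
    (is "even (card ?P)")
proof -
  let ?Q = "{(z, u, v). z > 0 \<and> u > 0 \<and> v > 0 \<and> 3 * u\<^sup>2 + 7 * v\<^sup>2 + 72 * z\<^sup>2 = 14 * k}"
  let ?n = "\<lambda>z. 7 * k - 36 * z\<^sup>2"
  let ?Z = "{z. z > 0 \<and> ?n z > 0}"
  have "?Z \<subseteq> {0..7 * k}"
  proof
    fix z assume z: "z \<in> ?Z"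
    then have "z * 1 \<le> z * z" by (intro mult_left_mono) auto
    moreover have "z > 0" "36 * (z * z) < 7 * k" using z by (simp_all add: power2_eq_square)
    ultimately have "z > 0" "z \<le> 7 * k" by linarith+
    then show "z \<in> {0..7 * k}" by simp
  qed
  then have fin: "finite ?Z" by (rule finite_subset) simp
  have pos: "\<alpha> * x\<^sup>2 + \<beta> * y\<^sup>2 > 0" if "x > 0" "y > 0" "\<alpha> > 0" "\<beta> > 0" for x y \<alpha> \<beta> :: int
    using that by (simp add: add_pos_pos)
  have P: "?P = (SIGMA z:?Z. reps 1 4 (?n z))"
    using pos[of _ _ 1 4] by (fastforce simp: reps_def)
  have Q: "?Q = (SIGMA z:?Z. reps 3 7 (2 * ?n z))"
    using pos[of _ _ 3 7] by (fastforce simp: reps_def)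
  have "[card (reps 1 4 (?n z)) = card (reps 3 7 (2 * ?n z))] (mod 2)" if z: "z \<in> ?Z" for z
  proof (cases "7 dvd z")
    case True
    then obtain w where w: "z = 7 * w" by (elim dvdE)
    have "reps 1 4 (?n z) = {}"
    proof (rule ccontr)
      assume "reps 1 4 (?n z) \<noteq> {}"
      then obtain x y where xy: "x\<^sup>2 + 4 * y\<^sup>2 = 7 * k - 36 * z\<^sup>2" by (auto simp: reps_def)
      then have "x\<^sup>2 + 4 * y\<^sup>2 = 7 * (k - 252 * w\<^sup>2)" unfolding w by (simp add: power_mult_distrib)
      then have "7 dvd x\<^sup>2 + 4 * y\<^sup>2" by simp
      then have "7 dvd x" "7 dvd y" using seven_dvd_norm by blast+
      then obtain a b where "x = 7 * a" "y = 7 * b" by (auto elim!: dvdE)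
      then have "k = 7 * (a\<^sup>2 + 4 * b\<^sup>2 + 36 * w\<^sup>2)" using xy unfolding w by (simp add: power_mult_distrib)
      then have "k mod 7 = 0" by simp
      then show False using k(2) by simp
    qed
    moreover have "reps 3 7 (2 * ?n z) = {}"
    proof (rule ccontr)
      assume "reps 3 7 (2 * ?n z) \<noteq> {}"
      then obtain u v where "3 * u\<^sup>2 + 7 * v\<^sup>2 = 2 * ?n z" by (auto simp: reps_def)
      then have "3 * u\<^sup>2 + 7 * v\<^sup>2 + 72 * z\<^sup>2 = 14 * k" by simp
      then show False using seven_dvd_3_7_72(1)[OF k(2)] True by blast
    qed
    ultimately show ?thesis by simp
  next
    case False
    have "?n z mod 12 = (7 * k + 12 * (- 3 * z\<^sup>2)) mod 12" by simp
    also have "\<dots> = (7 * (k mod 12)) mod 12" by (simp only: mod_mult_self2 mod_mult_right_eq)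
    finally have "?n z mod 12 = 5" using k(1) by simp
    moreover have "?n z mod 7 \<in> {3, 5, 6}"
    proof -
      have "z\<^sup>2 mod 7 \<in> {1, 2, 4}"
        using mod_square_cases(3)[of z] False seven_dvd_square_iff[of z] by (auto simp: dvd_eq_mod_eq_0)
      moreover have "?n z = (- (z\<^sup>2)) + 7 * (k - 5 * z\<^sup>2)" by simp
      then have "?n z mod 7 = (- (z\<^sup>2)) mod 7" by (simp only: mod_mult_self2)
      then have "?n z mod 7 = (- (z\<^sup>2 mod 7)) mod 7" by (simp only: mod_minus_eq)
      ultimately show ?thesis by (elim insertE emptyE) simp_all
    qed
    ultimately show ?thesis
      using even_card_reps_iff[of "?n z"] z by (simp add: cong_def mod2_eq_if)
  qed
  then have "[(\<Sum>z\<in>?Z. card (reps 1 4 (?n z))) = (\<Sum>z\<in>?Z. card (reps 3 7 (2 * ?n z)))] (mod 2)"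
    by (rule cong_sum)
  moreover have "card ?P = (\<Sum>z\<in>?Z. card (reps 1 4 (?n z)))" unfolding P
    by (rule card_SigmaI[OF fin]) (simp add: finite_reps)
  moreover have "card ?Q = (\<Sum>z\<in>?Z. card (reps 3 7 (2 * ?n z)))" unfolding Q
    by (rule card_SigmaI[OF fin]) (simp add: finite_reps)
  ultimately have "[card ?P = card ?Q] (mod 2)" by simp
  moreover have "odd k" using k(1) by presburger
  ultimately show ?thesis using even_card_3_7_72[OF _ k(2)]
    by (simp add: cong_def mod2_eq_if split: if_splits)
qed

section \<open>Theta series\<close>

text \<open>The generating series of the weights \<open>w x\<close> by the exponents
  \<open>t * x\<^sup>2\<close>, over \<open>x\<close> in \<open>S\<close>. For t > 0 every
  coefficient is a finite sum.\<close>

definition theta :: "int \<Rightarrow> int set \<Rightarrow> (int \<Rightarrow> int) \<Rightarrow> int fps" where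
  "theta t S w = Abs_fps (\<lambda>n. \<Sum>x | x \<in> S \<and> t * x\<^sup>2 = int n. w x)"

lemma abs_le_of_mult_square:
  fixes t x n :: int
  assumes "t > 0" "t * x\<^sup>2 \<le> n"
  shows "\<bar>x\<bar> \<le> n"
proof -
  have "\<bar>x\<bar> \<le> x\<^sup>2" using self_le_power[of "\<bar>x\<bar>" 2] by (cases "x = 0") auto
  also have "1 * x\<^sup>2 \<le> t * x\<^sup>2" using assms(1) by (intro mult_right_mono) auto
  finally show ?thesis using assms(2) by simp
qed

lemma finite_mult_square_le:
  fixes t n :: int
  assumes "t > 0"
  shows "finite {x. t * x\<^sup>2 \<le> n}"
  by (rule finite_subset[of _ "{- n..n}"]) (use abs_le_of_mult_square[OF assms] in \<open>force+\<close>)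

lemma finite_square_pairs:
  fixes t s n :: int
  assumes "t > 0" "s > 0"
  shows "finite {(x, y). t * x\<^sup>2 + s * y\<^sup>2 = n}"
proof (rule finite_subset)
  show "finite ({x. t * x\<^sup>2 \<le> n} \<times> {x. s * x\<^sup>2 \<le> n})" using assms by (simp add: finite_mult_square_le)
  have "t * x\<^sup>2 \<ge> 0" "s * x\<^sup>2 \<ge> 0" for x using assms by simp_all
  then show "{(x, y). t * x\<^sup>2 + s * y\<^sup>2 = n} \<subseteq> {x. t * x\<^sup>2 \<le> n} \<times> {x. s * x\<^sup>2 \<le> n}"
    by (auto simp: algebra_simps)
qed

lemma theta_nth_neq_0:
  assumes "theta t S w $ n \<noteq> 0"
  shows "\<exists>x\<in>S. int n = t * x\<^sup>2"
proof (rule ccontr)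
  assume "\<not> ?thesis"
  then have "{x. x \<in> S \<and> t * x\<^sup>2 = int n} = {}" by auto
  then have "theta t S w $ n = 0" unfolding theta_def fps_nth_Abs_fps by (simp only: sum.empty)
  then show False using assms by simp
qed

lemma theta_mult_nth:
  fixes g :: "int fps"
  assumes "t > 0"
  shows "(theta t S w * g) $ n = (\<Sum>x | x \<in> S \<and> t * x\<^sup>2 \<le> int n. w x * g $ (n - nat (t * x\<^sup>2)))"
proof -
  let ?P = "{x. x \<in> S \<and> t * x\<^sup>2 \<le> int n}"
  have fin: "finite ?P" by (rule finite_subset[OF _ finite_mult_square_le[OF assms]]) auto
  have "(\<Sum>x\<in>?P. w x * g $ (n - nat (t * x\<^sup>2))) =
      (\<Sum>i\<in>{0..n}. \<Sum>x\<in>{x\<in>?P. nat (t * x\<^sup>2) = i}. w x * g $ (n - nat (t * x\<^sup>2)))"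
    by (rule sum.group[symmetric]) (use fin in auto)
  also have "\<dots> = (\<Sum>i\<in>{0..n}. theta t S w $ i * g $ (n - i))"
  proof (rule sum.cong[OF refl])
    fix i assume "i \<in> {0..n}"
    then have "{x\<in>?P. nat (t * x\<^sup>2) = i} = {x. x \<in> S \<and> t * x\<^sup>2 = int i}"
      using assms by auto
    then show "(\<Sum>x\<in>{x\<in>?P. nat (t * x\<^sup>2) = i}. w x * g $ (n - nat (t * x\<^sup>2))) = theta t S w $ i * g $ (n - i)"
      by (simp add: theta_def sum_distrib_right)
  qed
  finally show ?thesis by (simp add: fps_mult_nth)
qed

lemma theta_mult_theta_nth:
  assumes "t > 0" "s > 0"
  shows "(theta t S w * theta s R v) $ n =
    (\<Sum>(x, y) | x \<in> S \<and> y \<in> R \<and> t * x\<^sup>2 + s * y\<^sup>2 = int n. w x * v y)"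
proof -
  let ?P = "{x. x \<in> S \<and> t * x\<^sup>2 \<le> int n}" and ?Q = "\<lambda>x. {y. y \<in> R \<and> s * y\<^sup>2 = int (n - nat (t * x\<^sup>2))}"
  have fin: "finite ?P" by (rule finite_subset[OF _ finite_mult_square_le[OF assms(1)]]) auto
  have fin': "finite (?Q x)" for x
    by (rule finite_subset[OF _ finite_mult_square_le[OF assms(2), of "int n"]]) auto
  have nn: "s * y\<^sup>2 \<ge> 0" "t * y\<^sup>2 \<ge> 0" for y using assms by simp_all
  have le: "t * x\<^sup>2 \<le> int n" if "t * x\<^sup>2 + s * y\<^sup>2 = int n" for x y
    using that nn(1)[of y] by linarith
  have eq: "{(x, y). x \<in> S \<and> y \<in> R \<and> t * x\<^sup>2 + s * y\<^sup>2 = int n} = (SIGMA x:?P. ?Q x)"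
    using assms le by (auto simp: of_nat_diff nat_le_iff)
  show ?thesis unfolding theta_mult_nth[OF assms(1)] eq
    by (subst sum.Sigma[symmetric]) (use fin fin' in \<open>auto simp: theta_def sum_distrib_left\<close>)
qed

section \<open>Divisibility of power series by integers\<close>

lemma numeral_dvd_fps_iff:
  fixes f :: "int fps"
  shows "numeral k dvd f \<longleftrightarrow> (\<forall>n. numeral k dvd f $ n)"
proof
  assume "numeral k dvd f"
  then show "\<forall>n. numeral k dvd f $ n" by (auto elim!: dvdE simp: numeral_fps_const)
next
  assume *: "\<forall>n. numeral k dvd f $ n"
  have "f = numeral k * Abs_fps (\<lambda>n. f $ n div numeral k)"
    using * by (simp add: fps_eq_iff numeral_fps_const)
  then show "numeral k dvd f" by (rule dvdI)
qed

text \<open>As the lowest coefficient of \<open>f\<close> is a unit, coefficient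
  \<open>d + n\<close> of \<open>f * g\<close> determines coefficient \<open>n\<close> of
  \<open>g\<close> from the earlier ones.\<close>

lemma numeral_dvd_fps_cancel:
  fixes f g :: "int fps"
  assumes dvd: "numeral k dvd f * g" and low: "\<And>i. i < d \<Longrightarrow> f $ i = 0" and unit: "is_unit (f $ d)"
  shows "numeral k dvd g"
  unfolding numeral_dvd_fps_iff
proof
  fix n
  show "numeral k dvd g $ n"
  proof (induction n rule: less_induct)
    case (less n)
    have "numeral k dvd (f * g) $ (d + n)" using dvd numeral_dvd_fps_iff by blast
    also have "(f * g) $ (d + n) = f $ d * g $ n + (\<Sum>i\<in>{0..d+n} - {d}. f $ i * g $ (d + n - i))"
      unfolding fps_mult_nth by (subst sum.remove[of _ d]) auto
    finally have "numeral k dvd f $ d * g $ n + (\<Sum>i\<in>{0..d+n} - {d}. f $ i * g $ (d + n - i))" .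
    moreover have "numeral k dvd (\<Sum>i\<in>{0..d+n} - {d}. f $ i * g $ (d + n - i))"
    proof (rule dvd_sum)
      fix i assume i: "i \<in> {0..d+n} - {d}"
      show "numeral k dvd f $ i * g $ (d + n - i)"
      proof (cases "i < d")
        case False
        then have "d + n - i < n" using i by auto
        then show ?thesis using less by simp
      qed (simp add: low)
    qed
    ultimately have "numeral k dvd f $ d * g $ n" by (simp add: dvd_add_left_iff)
    then show ?case using unit by (metis dvd_mult_unit_iff mult.commute)
  qed
qed

section \<open>Theta identities for residue classes modulo 3\<close>

definition res_class :: "int \<Rightarrow> int set" where
  "res_class r = {x. x mod 3 = r}"

text \<open>For \<open>c\<close> equal to 1 or -1 this is c^x, also for negative
  \<open>x\<close>.\<close>

definition weight :: "int \<Rightarrow> int \<Rightarrow> int" where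
  "weight c x = (if even x then 1 else c)"

text \<open>The substitution x = u + v, y = u - v parametrises the pairs of equal parity, and x = y
  modulo 3 means that 3 divides \<open>v\<close>. Moreover x^2 + y^2 = 2(u^2 + v^2), and the parity
  of \<open>x\<close> is that of u + v, so the weight of \<open>x\<close> is the product of those of
  \<open>u\<close> and \<open>v\<close>.\<close>

lemma theta_even_odd:
  fixes r t c :: int
  assumes c: "c * c = 1" and t: "t > 0"
  defines "E \<equiv> theta t (res_class r \<inter> {x. even x}) (\<lambda>_. 1)"
    and "D \<equiv> theta t (res_class r \<inter> {x. odd x}) (\<lambda>_. 1)"
  shows "E * E + fps_const c * (D * D) =
    theta (2 * t) (res_class r) (weight c) * theta (2 * t) (res_class 0) (weight c)"
proof (rule fps_ext)
  fix n
  let ?P = "{(x, y). x \<in> res_class r \<inter> {x. even x} \<and> y \<in> res_class r \<inter> {x. even x} \<and> t * x\<^sup>2 + t * y\<^sup>2 = int n}"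
  let ?Q = "{(x, y). x \<in> res_class r \<inter> {x. odd x} \<and> y \<in> res_class r \<inter> {x. odd x} \<and> t * x\<^sup>2 + t * y\<^sup>2 = int n}"
  let ?R = "{(x, y). x \<in> res_class r \<and> y \<in> res_class 0 \<and> 2 * t * x\<^sup>2 + 2 * t * y\<^sup>2 = int n}"
  have fin: "finite ?P" "finite ?Q"
    by (rule finite_subset[OF _ finite_square_pairs[OF t t, of "int n"]]; auto)+
  have "(E * E + fps_const c * (D * D)) $ n = (\<Sum>(x, y)\<in>?P. 1) + (\<Sum>(x, y)\<in>?Q. c)"
    using t by (simp add: E_def D_def theta_mult_theta_nth sum_distrib_left split_beta)
  also have "\<dots> = (\<Sum>(x, y)\<in>?P. weight c x) + (\<Sum>(x, y)\<in>?Q. weight c x)"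
    by (intro arg_cong2[where f = "(+)"] sum.cong) (auto simp: weight_def)
  also have "\<dots> = (\<Sum>(x, y)\<in>?P \<union> ?Q. weight c x)"
    using fin by (intro sum.union_disjoint[symmetric]) auto
  also have "\<dots> = (\<Sum>(x, y)\<in>?R. weight c x * weight c y)"
  proof (rule sum.reindex_bij_witness[where i = "\<lambda>(u, v). (u + v, u - v)" and j = "\<lambda>(x, y). ((x + y) div 2, (x - y) div 2)"])
    fix p assume "p \<in> ?P \<union> ?Q"
    then obtain x y where p: "p = (x, y)" and xy: "x mod 3 = r" "y mod 3 = r" "even x \<longleftrightarrow> even y"
      "t * x\<^sup>2 + t * y\<^sup>2 = int n" by (auto simp: res_class_def)
    have "even (x + y)" "even (x - y)" using xy(3) by auto
    then obtain u v where uv: "x + y = 2 * u" "x - y = 2 * v" by (metis evenE)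
    then have x: "x = u + v" "y = u - v" by auto
    have "3 dvd x - y" using xy by (metis mod_eq_dvd_iff)
    then have "3 dvd v" unfolding uv(2) by presburger
    then have "v mod 3 = 0" "u mod 3 = r" using xy(1) unfolding x by (auto elim!: dvdE)
    then show "(case p of (x, y) \<Rightarrow> ((x + y) div 2, (x - y) div 2)) \<in> ?R"
      using xy(4) unfolding p x res_class_def by (simp add: power2_eq_square algebra_simps)
    show "(case case p of (x, y) \<Rightarrow> ((x + y) div 2, (x - y) div 2) of (u, v) \<Rightarrow> (u + v, u - v)) = p"
      unfolding p x by simp
    show "(case case p of (x, y) \<Rightarrow> ((x + y) div 2, (x - y) div 2) of (x, y) \<Rightarrow> weight c x * weight c y) = (case p of (x, y) \<Rightarrow> weight c x)"
      unfolding p x using c by (simp add: weight_def)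
  next
    fix p assume "p \<in> ?R"
    then obtain u v where p: "p = (u, v)" and uv: "u mod 3 = r" "v mod 3 = 0" "2 * t * u\<^sup>2 + 2 * t * v\<^sup>2 = int n"
      by (auto simp: res_class_def)
    show "(case case p of (u, v) \<Rightarrow> (u + v, u - v) of (x, y) \<Rightarrow> ((x + y) div 2, (x - y) div 2)) = p"
      unfolding p by simp
    have "3 dvd v" using uv(2) by presburger
    then have "(u + v) mod 3 = r" "(u - v) mod 3 = r" using uv(1) by (auto elim!: dvdE simp: mod_diff_right_eq) (metis minus_mult_right mod_mult_self2 diff_conv_add_uminus)
    then show "(case p of (u, v) \<Rightarrow> (u + v, u - v)) \<in> ?P \<union> ?Q"
      using uv(3) unfolding p res_class_def by (auto simp: power2_eq_square algebra_simps)
  qed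
  also have "\<dots> = (theta (2 * t) (res_class r) (weight c) * theta (2 * t) (res_class 0) (weight c)) $ n"
    using t by (subst theta_mult_theta_nth) auto
  finally show "(E * E + fps_const c * (D * D)) $ n = \<dots>" .
qed

abbreviation evens :: "int \<Rightarrow> int set" where "evens r \<equiv> res_class r \<inter> {x. even x}"
abbreviation odds :: "int \<Rightarrow> int set" where "odds r \<equiv> res_class r \<inter> {x. odd x}"

lemma theta_Un:
  assumes "t > 0" "S \<inter> R = {}"
  shows "theta t (S \<union> R) w = theta t S w + theta t R w"
proof (rule fps_ext)
  fix n
  have "finite {x. x \<in> U \<and> t * x\<^sup>2 = int n}" for U
    by (rule finite_subset[OF _ finite_mult_square_le[OF assms(1), of "int n"]]) auto
  then have "(\<Sum>x\<in>{x. x \<in> S \<and> t * x\<^sup>2 = int n} \<union> {x. x \<in> R \<and> t * x\<^sup>2 = int n}. w x) =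
      (\<Sum>x | x \<in> S \<and> t * x\<^sup>2 = int n. w x) + (\<Sum>x | x \<in> R \<and> t * x\<^sup>2 = int n. w x)"
    using assms(2) by (intro sum.union_disjoint) auto
  moreover have "{x. x \<in> S \<and> t * x\<^sup>2 = int n} \<union> {x. x \<in> R \<and> t * x\<^sup>2 = int n} = {x. x \<in> S \<union> R \<and> t * x\<^sup>2 = int n}"
    by auto
  ultimately show "theta t (S \<union> R) w $ n = (theta t S w + theta t R w) $ n"
    by (simp add: theta_def)
qed

lemma theta_weight:
  assumes "t > 0"
  shows "theta t (res_class r) (weight 1) = theta t (evens r) (\<lambda>_. 1) + theta t (odds r) (\<lambda>_. 1)"
    and "theta t (res_class r) (weight (- 1)) = theta t (evens r) (\<lambda>_. 1) - theta t (odds r) (\<lambda>_. 1)"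
proof -
  have S: "res_class r = evens r \<union> odds r" by auto
  have "theta t (res_class r) (weight c) = theta t (evens r) (\<lambda>_. 1) + fps_const c * theta t (odds r) (\<lambda>_. 1)" for c
  proof -
    have "theta t (res_class r) (weight c) = theta t (evens r) (weight c) + theta t (odds r) (weight c)"
      using theta_Un[OF assms, of "evens r" "odds r" "weight c"] S by auto
    also have "theta t (evens r) (weight c) = theta t (evens r) (\<lambda>_. 1)"
      unfolding theta_def by (intro arg_cong[where f = Abs_fps] ext sum.cong) (auto simp: weight_def)
    also have "theta t (odds r) (weight c) = fps_const c * theta t (odds r) (\<lambda>_. 1)"
      unfolding theta_def by (rule fps_ext) (simp add: sum_distrib_left weight_def)
    finally show ?thesis .
  qed
  from this[of 1] this[of "- 1"]
  show "theta t (res_class r) (weight 1) = theta t (evens r) (\<lambda>_. 1) + theta t (odds r) (\<lambda>_. 1)"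
    and "theta t (res_class r) (weight (- 1)) = theta t (evens r) (\<lambda>_. 1) - theta t (odds r) (\<lambda>_. 1)"
    by (simp_all add: fps_const_neg[symmetric] del: fps_const_neg)
qed

text \<open>With even part E and odd part D, the left side is (E + D)(E - D) = E^2 - D^2, the case c
  = -1 of \<open>theta_even_odd\<close>.\<close>

lemma theta_mult_signed:
  assumes "t > 0"
  shows "theta t (res_class r) (weight 1) * theta t (res_class r) (weight (- 1)) =
    theta (2 * t) (res_class r) (weight (- 1)) * theta (2 * t) (res_class 0) (weight (- 1))"
  using theta_even_odd[of "- 1" t r] assms
  by (simp add: theta_weight algebra_simps fps_const_neg[symmetric] del: fps_const_neg)

text \<open>E^2 + D^2 and E^2 - D^2 are products of series at scale \<open>2 * t\<close>. Regrouping
  pairs each unsigned series with its signed partner, and \<open>theta_mult_signed\<close> moves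
  both pairs to scale \<open>4 * t\<close>.\<close>

lemma theta_pow4_diff:
  assumes "t > 0"
  shows "theta t (evens r) (\<lambda>_. 1) ^ 4 - theta t (odds r) (\<lambda>_. 1) ^ 4 =
    theta (4 * t) (res_class r) (weight (- 1)) * theta (4 * t) (res_class 0) (weight (- 1)) ^ 3"
proof -
  let ?E = "theta t (evens r) (\<lambda>_. 1)" and ?D = "theta t (odds r) (\<lambda>_. 1)"
  let ?\<theta> = "\<lambda>t r c. theta t (res_class r) (weight c)"
  have "?E ^ 4 - ?D ^ 4 = (?E * ?E + fps_const 1 * (?D * ?D)) * (?E * ?E + fps_const (- 1) * (?D * ?D))"
    by (simp add: algebra_simps power4_eq_xxxx fps_const_neg[symmetric] del: fps_const_neg)
  also have "\<dots> = (?\<theta> (2 * t) r 1 * ?\<theta> (2 * t) 0 1) * (?\<theta> (2 * t) r (- 1) * ?\<theta> (2 * t) 0 (- 1))"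
    using theta_even_odd[of 1 t r] theta_even_odd[of "- 1" t r] assms by simp
  also have "\<dots> = (?\<theta> (2 * t) r 1 * ?\<theta> (2 * t) r (- 1)) * (?\<theta> (2 * t) 0 1 * ?\<theta> (2 * t) 0 (- 1))"
    by (simp add: mult_ac)
  also have "\<dots> = (?\<theta> (4 * t) r (- 1) * ?\<theta> (4 * t) 0 (- 1)) * (?\<theta> (4 * t) 0 (- 1) * ?\<theta> (4 * t) 0 (- 1))"
    using theta_mult_signed[of "2 * t"] assms by simp
  finally show ?thesis by (simp add: power3_eq_cube mult_ac)
qed

lemma theta_cong_2:
  assumes "t > 0" "\<And>x. x \<in> S \<Longrightarrow> even (w x - v x)"
  shows "2 dvd theta t S w - theta t S v"
  unfolding numeral_dvd_fps_iff theta_def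
  by (auto simp: sum_subtractf[symmetric] intro!: dvd_sum assms(2))

text \<open>The weight is an even function, so \<open>x\<close> and \<open>- x\<close> contribute
  equally, and \<open>x = 0\<close> gives the constant 1.\<close>

lemma theta_0_eq:
  assumes "t > 0"
  shows "theta t (res_class 0) (weight c) = 1 + 2 * theta t (res_class 0 \<inter> {x. x > 0}) (weight c)"
proof (rule fps_ext)
  fix n
  let ?P = "{x. x \<in> res_class 0 \<inter> {x. x > 0} \<and> t * x\<^sup>2 = int n}"
  let ?N = "{x. x \<in> res_class 0 \<inter> {x. x < 0} \<and> t * x\<^sup>2 = int n}"
  let ?Z = "{x :: int. x = 0 \<and> int n = 0}"
  have fin: "finite {x. x \<in> U \<and> t * x\<^sup>2 = int n}" for U
    by (rule finite_subset[OF _ finite_mult_square_le[OF assms(1), of "int n"]]) auto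
  have "{x. x \<in> res_class 0 \<and> t * x\<^sup>2 = int n} = (?P \<union> ?N) \<union> ?Z"
  proof (rule Set.set_eqI)
    show "x \<in> {x. x \<in> res_class 0 \<and> t * x\<^sup>2 = int n} \<longleftrightarrow> x \<in> (?P \<union> ?N) \<union> ?Z" for x
      by (cases "x = 0") (auto simp: res_class_def)
  qed
  then have "theta t (res_class 0) (weight c) $ n = (\<Sum>x\<in>(?P \<union> ?N) \<union> ?Z. weight c x)"
    by (simp add: theta_def)
  also have "\<dots> = (\<Sum>x\<in>?P \<union> ?N. weight c x) + (\<Sum>x\<in>?Z. weight c x)"
    using fin[of "res_class 0 \<inter> {x. x > 0}"] fin[of "res_class 0 \<inter> {x. x < 0}"]
    by (intro sum.union_disjoint) auto
  also have "(\<Sum>x\<in>?P \<union> ?N. weight c x) = (\<Sum>x\<in>?P. weight c x) + (\<Sum>x\<in>?N. weight c x)"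
    using fin[of "res_class 0 \<inter> {x. x > 0}"] fin[of "res_class 0 \<inter> {x. x < 0}"]
    by (intro sum.union_disjoint) auto
  also have "(\<Sum>x\<in>?N. weight c x) = (\<Sum>x\<in>?P. weight c x)"
    by (rule sum.reindex_bij_witness[of _ uminus uminus]) (auto simp: weight_def res_class_def zmod_zminus1_eq_if)
  also have "(\<Sum>x\<in>?Z. weight c x) = (if n = 0 then 1 else 0)"
    by (cases "n = 0") (simp_all add: weight_def)
  finally show "theta t (res_class 0) (weight c) $ n = (1 + 2 * theta t (res_class 0 \<inter> {x. x > 0}) (weight c)) $ n"
    by (simp add: theta_def numeral_fps_const)
qed

text \<open>In the expansion of (y + 2h)^4 every term other than y^4 is divisible by 8.\<close>

lemma pow4_cong_8:
  fixes x y :: "'a :: comm_ring_1"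
  assumes "2 dvd x - y"
  shows "8 dvd x ^ 4 - y ^ 4"
proof -
  obtain h where "x - y = 2 * h" using assms by (elim dvdE)
  then have x: "x = y + 2 * h" by (simp add: algebra_simps)
  have "x ^ 4 - y ^ 4 = 8 * (y ^ 3 * h + 3 * (y\<^sup>2 * h\<^sup>2) + 4 * (y * h ^ 3) + 2 * h ^ 4)"
    unfolding x by (simp add: power4_eq_xxxx power3_eq_cube power2_eq_square algebra_simps)
  then show ?thesis by (rule dvdI)
qed

section \<open>Sections of a power series by exponents modulo 4\<close>

definition slice :: "nat \<Rightarrow> int fps \<Rightarrow> int fps" where
  "slice r f = Abs_fps (\<lambda>n. if n mod 4 = r then f $ n else 0)"

definition exps_mod_4 :: "nat \<Rightarrow> int fps \<Rightarrow> bool" where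
  "exps_mod_4 r f \<longleftrightarrow> (\<forall>n. f $ n \<noteq> 0 \<longrightarrow> n mod 4 = r mod 4)"

lemma fps_mult_nth_neq_0E:
  fixes f g :: "'a :: comm_ring_1 fps"
  assumes "(f * g) $ n \<noteq> 0"
  obtains i j where "n = i + j" "f $ i \<noteq> 0" "g $ j \<noteq> 0"
proof -
  obtain i where "i \<in> {0..n}" "f $ i * g $ (n - i) \<noteq> 0"
    using assms unfolding fps_mult_nth by (meson sum.not_neutral_contains_not_neutral)
  then have "n = i + (n - i)" "f $ i \<noteq> 0" "g $ (n - i) \<noteq> 0" by auto
  then show thesis by (rule that)
qed

lemma exps_mod_4_mult:
  assumes "exps_mod_4 r f" "exps_mod_4 s g"
  shows "exps_mod_4 (r + s) (f * g)"
  unfolding exps_mod_4_def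
proof (intro allI impI)
  fix n assume "(f * g) $ n \<noteq> 0"
  then obtain i j where "n = i + j" "f $ i \<noteq> 0" "g $ j \<noteq> 0" by (rule fps_mult_nth_neq_0E)
  then show "n mod 4 = (r + s) mod 4" using assms mod_add_cong unfolding exps_mod_4_def by blast
qed

lemma slice_simps:
  "slice r (f + g) = slice r f + slice r g"
  "slice r (f - g) = slice r f - slice r g"
  by (auto simp: slice_def fps_eq_iff)

lemma slice_exps_mod_4:
  assumes "exps_mod_4 s f" "r < 4"
  shows "slice r f = (if s mod 4 = r then f else 0)"
  using assms by (auto simp: slice_def exps_mod_4_def fps_eq_iff)

lemma exps_mod_4_slice: "r < 4 \<Longrightarrow> exps_mod_4 r (slice r f)"
  by (simp add: slice_def exps_mod_4_def)

text \<open>Split \<open>f\<close> into its four sections; multiplication by a series in q^4 keeps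
  each of them in its class.\<close>

lemma slice_mult:
  assumes "exps_mod_4 0 g" "r < 4"
  shows "slice r (f * g) = slice r f * g"
proof -
  have f: "f = slice 0 f + slice 1 f + slice 2 f + slice 3 f"
  proof (rule fps_ext)
    fix n :: nat
    have "n mod 4 = 0 \<or> n mod 4 = 1 \<or> n mod 4 = 2 \<or> n mod 4 = 3" by presburger
    then show "f $ n = (slice 0 f + slice 1 f + slice 2 f + slice 3 f) $ n"
      by (auto simp: slice_def)
  qed
  have "slice r (slice s f * g) = (if s = r then slice s f * g else 0)" if "s < 4" for s
    using slice_exps_mod_4[OF exps_mod_4_mult[OF exps_mod_4_slice[OF that, of f] assms(1)] assms(2)] that by simp
  note * = this[of 0] this[of 1] this[of 2] this[of 3]
  have "slice r (f * g) = slice r (slice 0 f * g) + slice r (slice 1 f * g) + slice r (slice 2 f * g) + slice r (slice 3 f * g)"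
    by (subst f) (simp only: distrib_right slice_simps)
  also have "\<dots> = slice r f * g"
  proof -
    have "r = 0 \<or> r = 1 \<or> r = 2 \<or> r = 3" using assms(2) by linarith
    then show ?thesis using * by (elim disjE) simp_all
  qed
  finally show ?thesis .
qed

lemma numeral_dvd_slice: "numeral k dvd f \<Longrightarrow> numeral k dvd slice r f"
  unfolding numeral_dvd_fps_iff by (simp add: slice_def)

section \<open>The reciprocal of the false theta function\<close>

text \<open>The term of \<open>\<Psi>\<close> with index \<open>n\<close> has exponent \<open>3 n\<^sup>2 + 2 n = (x\<^sup>2 - 1) / 3\<close> with
  \<open>x = 3 n + 1\<close>, and \<open>psi_sign x\<close> is its sign.\<close>
definition psi_sign :: "int \<Rightarrow> int" where
  "psi_sign x = (let n = x div 3 in (if n \<ge> 0 then 1 else - 1) * (- 1) ^ nat (n * (n + 1) div 2))"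

lemma odd_psi_sign: "odd (psi_sign x)"
  by (simp add: psi_sign_def Let_def)

text \<open>With x = 3n + 1 one has x^2 = 3(3n^2 + 2n) + 1, so the theta series is q times the power
  series of \<Psi> at q^3. Substituting q^3 in the reciprocal identity and multiplying by q gives
  the claim.\<close>

lemma c5_theta:
  "(Abs_fps c5 oo fps_X ^ 3) * theta 1 (res_class 1) psi_sign = fps_X"
proof -
  obtain p :: "int fps" where P: "Psi (- (fps_X ^ 5)) fps_X = Abs_fps (\<lambda>k. rat_of_int (p $ k))"
    and p: "\<And>k. p $ k =
           (\<Sum>n | n \<ge> 0 \<and> nat (3 * n\<^sup>2 + 2 * n) = k. (-1) ^ nat (n * (n + 1) div 2)) -
           (\<Sum>n | n \<le> -1 \<and> nat (3 * n\<^sup>2 + 2 * n) = k. (-1) ^ nat (n * (n + 1) div 2))"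
    and p0: "p $ 0 = 1"
    using Psi_eq by blast
  let ?P = "Abs_fps (\<lambda>k. rat_of_int (p $ k))"
  have "?P $ 0 \<noteq> 0" by (simp add: p0)
  then have inv: "Abs_fps (\<lambda>n. rat_of_int (c5 n)) * ?P = 1"
    using c5_gf unfolding P by (simp add: fps_divide_unit inverse_mult_eq_1)
  have "Abs_fps c5 * p = 1"
  proof (rule fps_ext)
    fix n
    have "rat_of_int ((Abs_fps c5 * p) $ n) = (Abs_fps (\<lambda>n. rat_of_int (c5 n)) * ?P) $ n"
      by (simp add: fps_mult_nth)
    also have "\<dots> = rat_of_int (1 $ n)" unfolding inv by simp
    finally show "(Abs_fps c5 * p) $ n = 1 $ n" by (simp only: of_int_eq_iff)
  qed
  then have "(Abs_fps c5 oo fps_X ^ 3) * (p oo fps_X ^ 3) = 1"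
    by (simp flip: fps_compose_mult_distrib)
  moreover have "theta 1 (res_class 1) psi_sign = fps_X * (p oo fps_X ^ 3)"
  proof (rule fps_ext)
    fix m
    show "theta 1 (res_class 1) psi_sign $ m = (fps_X * (p oo fps_X ^ 3)) $ m"
    proof (cases "m mod 3 = 1")
      case False
      \<comment> \<open>Both sides have only exponents that are 1 modulo 3.\<close>
      have "theta 1 (res_class 1) psi_sign $ m = 0"
      proof (rule ccontr)
        assume "theta 1 (res_class 1) psi_sign $ m \<noteq> 0"
        then obtain x where x: "x mod 3 = 1" "int m = 1 * x\<^sup>2"
          using theta_nth_neq_0 by (fastforce simp: res_class_def)
        then obtain y where "x = 3 * y + 1" by (metis mult_div_mod_eq)
        then have "int m = 1 + 3 * (3 * y\<^sup>2 + 2 * y)" using x(2) by (simp add: power2_eq_square algebra_simps)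
        then have "int m mod 3 = 1 mod 3" by (simp only: mod_mult_self2)
        then have "int (m mod 3) = 1" by (simp add: zmod_int)
        then show False using False by simp
      qed
      moreover have "m = 0 \<or> \<not> 3 dvd m - 1" using False by presburger
      ultimately show ?thesis by (auto simp: fps_nth_compose_X_power)
    next
      case True
      define k where "k = m div 3"
      have m: "m = 3 * k + 1" using True unfolding k_def by presburger
      let ?A = "{n. n \<ge> 0 \<and> nat (3 * n\<^sup>2 + 2 * n) = k}" and ?B = "{n. n \<le> -1 \<and> nat (3 * n\<^sup>2 + 2 * n) = k}"
      let ?s = "\<lambda>n :: int. (-1) ^ nat (n * (n + 1) div 2) :: int"
      have ge: "3 * n\<^sup>2 + 2 * n \<ge> 0" for n :: int using Psi_exponent_ge[of n] by simp
      have fin: "finite {n. nat (3 * n\<^sup>2 + 2 * n) = k}"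
      proof (rule finite_subset)
        show "{n. nat (3 * n\<^sup>2 + 2 * n) = k} \<subseteq> {- int k..int k}"
        proof
          fix n assume "n \<in> {n. nat (3 * n\<^sup>2 + 2 * n) = k}"
          with Psi_exponent_ge[of n] show "n \<in> {- int k..int k}" by auto
        qed
      qed simp
      have "theta 1 (res_class 1) psi_sign $ m = (\<Sum>n\<in>?A \<union> ?B. (if n \<ge> 0 then 1 else - 1) * ?s n)"
        unfolding theta_def fps_nth_Abs_fps
      proof (rule sum.reindex_bij_witness[of _ "\<lambda>n. 3 * n + 1" "\<lambda>x. x div 3"])
        fix x assume "x \<in> {x \<in> res_class 1. 1 * x\<^sup>2 = int m}"
        then have x: "x mod 3 = 1" "x\<^sup>2 = int m" by (auto simp: res_class_def)
        define y where "y = x div 3"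
        have xy: "x = 3 * y + 1" using x(1) unfolding y_def by presburger
        have "3 * y\<^sup>2 + 2 * y = int k" using x(2) unfolding xy m by (simp add: power2_eq_square algebra_simps)
        then have "nat (3 * y\<^sup>2 + 2 * y) = k" by simp
        then show "x div 3 \<in> ?A \<union> ?B" unfolding y_def[symmetric] by (cases "y \<ge> 0") simp_all
        show "3 * (x div 3) + 1 = x" using xy unfolding y_def[symmetric] by simp
        show "(if x div 3 \<ge> 0 then 1 else - 1) * ?s (x div 3) = psi_sign x"
          by (simp add: psi_sign_def Let_def)
      next
        fix n assume "n \<in> ?A \<union> ?B"
        then have n: "3 * n\<^sup>2 + 2 * n = int k" using ge[of n] by auto
        then have "(3 * n + 1)\<^sup>2 = int m" unfolding m by (simp add: power2_eq_square algebra_simps)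
        then show "3 * n + 1 \<in> {x \<in> res_class 1. 1 * x\<^sup>2 = int m}" by (simp add: res_class_def)
        show "(3 * n + 1) div 3 = n" by simp
      qed
      also have "\<dots> = (\<Sum>n\<in>?A. (if n \<ge> 0 then 1 else - 1) * ?s n) + (\<Sum>n\<in>?B. (if n \<ge> 0 then 1 else - 1) * ?s n)"
        by (intro sum.union_disjoint) (auto intro!: finite_subset[OF _ fin])
      also have "\<dots> = (\<Sum>n\<in>?A. ?s n) - (\<Sum>n\<in>?B. ?s n)"
        unfolding diff_conv_add_uminus sum_negf[symmetric] by (intro arg_cong2[where f = "(+)"] sum.cong) auto
      finally show ?thesis by (simp add: p m fps_nth_compose_X_power)
    qed
  qed
  ultimately show ?thesis by (simp add: mult.left_commute)
qed

text \<open>Multiply C B by g^4, which is 1 modulo 8. Then B g^3 becomes E^4 - D^4 = (E + D)(E^3 -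
  E^2 D + E D^2 - D^3), and C (E + D) = X.\<close>

lemma eighth_power_step:
  fixes C X g B E D :: "'a :: comm_ring_1"
  assumes "C * (E + D) = X" "8 dvd (E ^ 4 - D ^ 4) - B * g ^ 3" "8 dvd g ^ 4 - 1"
  shows "8 dvd C * B - X * g * (E ^ 3 - E\<^sup>2 * D + E * D\<^sup>2 - D ^ 3)"
proof -
  have "8 dvd - (C * B) * (g ^ 4 - 1) - (g * C) * ((E ^ 4 - D ^ 4) - B * g ^ 3)"
    by (rule dvd_diff[OF dvd_mult[OF assms(3)] dvd_mult[OF assms(2)]])
  also have "\<dots> = C * B - (C * (E + D)) * g * (E ^ 3 - E\<^sup>2 * D + E * D\<^sup>2 - D ^ 3)"
    by (simp add: power4_eq_xxxx power3_eq_cube power2_eq_square algebra_simps)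
  finally show ?thesis unfolding assms(1) .
qed

text \<open>\<open>theta_e\<close> and \<open>theta_o\<close> are the parts of \<open>q \<Psi>(-q\<^sup>1\<^sup>5, q\<^sup>3)\<close> with even and odd
  exponents; \<open>c5_series\<close> is \<open>\<Sum>\<^sub>N c\<^sub>5(N) q\<^bsup>3N\<^esup>\<close>.\<close>
definition theta_e :: "int fps" where "theta_e = theta 1 (evens 1) psi_sign"
definition theta_o :: "int fps" where "theta_o = theta 1 (odds 1) psi_sign"
text \<open>\<open>theta_1\<close> and \<open>theta_0\<close> are the series b and g in the identity
  E^4 - D^4 = b g^3; \<open>theta_0_half\<close> is half of \<open>theta_0 - 1\<close>.\<close>

definition theta_1 :: "int fps" where "theta_1 = theta 4 (res_class 1) (weight (- 1))"
definition theta_0 :: "int fps" where "theta_0 = theta 4 (res_class 0) (weight (- 1))"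
definition theta_0_half :: "int fps" where "theta_0_half = theta 4 (res_class 0 \<inter> {x. x > 0}) (weight (- 1))"
definition c5_series :: "int fps" where "c5_series = Abs_fps c5 oo fps_X ^ 3"

lemma theta_0_half: "theta_0 = 1 + 2 * theta_0_half"
  unfolding theta_0_def theta_0_half_def by (rule theta_0_eq) simp

text \<open>An even x that is 1 modulo 3 is -2y with y again 1 modulo 3, and x^2 = 4y^2. The weights
  are odd on both sides, hence agree modulo 2.\<close>

lemma theta_e_cong: "2 dvd theta_e - theta_1"
proof -
  have "theta_1 = theta 1 (evens 1) (\<lambda>x. weight (- 1) (x div 2))"
    unfolding theta_1_def theta_def
  proof (intro arg_cong[where f = Abs_fps] ext)
    fix n
    show "(\<Sum>x | x \<in> res_class 1 \<and> 4 * x\<^sup>2 = int n. weight (- 1) x) =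
      (\<Sum>x | x \<in> evens 1 \<and> 1 * x\<^sup>2 = int n. weight (- 1) (x div 2))"
    proof (rule sum.reindex_bij_witness[of _ "\<lambda>x. - (x div 2)" "\<lambda>x. - 2 * x"])
      fix x assume "x \<in> {x. x \<in> res_class 1 \<and> 4 * x\<^sup>2 = int n}"
      then have x: "x mod 3 = 1" "4 * x\<^sup>2 = int n" by (auto simp: res_class_def)
      have "(- 2 * x) mod 3 = 1" using x(1) by presburger
      then show "- 2 * x \<in> {x. x \<in> evens 1 \<and> 1 * x\<^sup>2 = int n}" using x(2)
        by (simp add: res_class_def power_mult_distrib)
      have "(- 2 * x) div 2 = - x" by presburger
      then show "weight (- 1) ((- 2 * x) div 2) = weight (- 1) x" by (simp add: weight_def)
      show "- ((- 2 * x) div 2) = x" by presburger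
    next
      fix x assume "x \<in> {x. x \<in> evens 1 \<and> 1 * x\<^sup>2 = int n}"
      then have x: "x mod 3 = 1" "even x" "x\<^sup>2 = int n" by (auto simp: res_class_def)
      then obtain y where y: "x = 2 * y" by (elim evenE)
      have "(- y) mod 3 = 1" using x(1) unfolding y by presburger
      then show "- (x div 2) \<in> {x. x \<in> res_class 1 \<and> 4 * x\<^sup>2 = int n}" using x(3) unfolding y
        by (simp add: res_class_def power_mult_distrib)
      show "- 2 * (- (x div 2)) = x" unfolding y by simp
    qed
  qed
  then show ?thesis unfolding theta_e_def
    using theta_cong_2[of 1 "evens 1" psi_sign "\<lambda>x. weight (- 1) (x div 2)"]
    by (simp add: odd_psi_sign weight_def)
qed

lemma theta_0_pow4: "8 dvd theta_0 ^ 4 - 1"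
  using pow4_cong_8[of theta_0 1] unfolding theta_0_half by simp

text \<open>In fourth powers modulo 8, \<open>psi_sign\<close> may be replaced by 1; then
  \<open>theta_pow4_diff\<close> at scale 1 supplies what \<open>eighth_power_step\<close> asks
  for.\<close>

lemma c5_series_cong_8:
  "8 dvd c5_series * theta_1 - fps_X * theta_0 * (theta_e ^ 3 - theta_e\<^sup>2 * theta_o + theta_e * theta_o\<^sup>2 - theta_o ^ 3)"
proof (rule eighth_power_step[OF _ _ theta_0_pow4])
  have "theta_e + theta_o = theta 1 (evens 1 \<union> odds 1) psi_sign"
    unfolding theta_e_def theta_o_def by (rule theta_Un[symmetric]) auto
  also have "evens 1 \<union> odds 1 = res_class 1" by auto
  finally show "c5_series * (theta_e + theta_o) = fps_X" using c5_theta by (simp add: c5_series_def)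
  have "8 dvd theta_e ^ 4 - theta 1 (evens 1) (\<lambda>_. 1) ^ 4" "8 dvd theta_o ^ 4 - theta 1 (odds 1) (\<lambda>_. 1) ^ 4"
    unfolding theta_e_def theta_o_def by (intro pow4_cong_8 theta_cong_2; simp add: odd_psi_sign)+
  from dvd_diff[OF this]
  have "8 dvd (theta_e ^ 4 - theta_o ^ 4) - (theta 1 (evens 1) (\<lambda>_. 1) ^ 4 - theta 1 (odds 1) (\<lambda>_. 1) ^ 4)"
    by (simp add: algebra_simps)
  then show "8 dvd (theta_e ^ 4 - theta_o ^ 4) - theta_1 * theta_0 ^ 3"
    using theta_pow4_diff[of 1 1] by (simp add: theta_1_def theta_0_def)
qed

lemma exps_mod_4_theta:
  assumes "\<And>x. x \<in> S \<Longrightarrow> t * x\<^sup>2 mod 4 = int r" "r < 4"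
  shows "exps_mod_4 r (theta t S w)"
  unfolding exps_mod_4_def
proof (intro allI impI)
  fix n assume "theta t S w $ n \<noteq> 0"
  then obtain x where "x \<in> S" "int n = t * x\<^sup>2" using theta_nth_neq_0 by blast
  then have "int n mod 4 = int r" using assms(1) by simp
  then have "int (n mod 4) = int r" by (simp add: zmod_int)
  then show "n mod 4 = r mod 4" using assms(2) by simp
qed

lemma odd_square_mod_4:
  fixes x :: int
  assumes "odd x"
  shows "x\<^sup>2 mod 4 = 1"
proof -
  from assms obtain y where "x = 2 * y + 1" by (elim oddE)
  then have "x\<^sup>2 = 1 + 4 * (y * (y + 1))" by (simp add: power2_eq_square algebra_simps)
  then have "x\<^sup>2 mod 4 = 1 mod 4" by (simp only: mod_mult_self2)
  then show ?thesis by simp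
qed

lemma exps_mod_4_simps:
  "exps_mod_4 0 theta_e" "exps_mod_4 1 theta_o" "exps_mod_4 0 theta_1" "exps_mod_4 0 theta_0" "exps_mod_4 1 fps_X"
proof -
  show "exps_mod_4 0 theta_e" unfolding theta_e_def
    by (rule exps_mod_4_theta) (auto elim!: evenE simp: power_mult_distrib)
  show "exps_mod_4 1 theta_o" unfolding theta_o_def
    by (rule exps_mod_4_theta) (auto simp: odd_square_mod_4)
  show "exps_mod_4 0 theta_1" "exps_mod_4 0 theta_0" unfolding theta_1_def theta_0_def
    by (rule exps_mod_4_theta; simp)+
  show "exps_mod_4 1 fps_X" by (simp add: exps_mod_4_def fps_X_def)
qed

text \<open>The exponents of \<open>theta_o\<close> are 1 modulo 4, those of \<open>theta_e\<close>,
  \<open>theta_1\<close> and \<open>theta_0\<close> are 0. The four products in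
  \<open>c5_series_cong_8\<close> thus lie in the classes 1, 2, 3, 0, and taking sections isolates
  the first two.\<close>

lemma slice_c5_series:
  "8 dvd slice 1 c5_series * theta_1 - fps_X * theta_0 * theta_e ^ 3"
  "8 dvd slice 2 c5_series * theta_1 + fps_X * theta_0 * theta_e\<^sup>2 * theta_o"
proof -
  note mult = exps_mod_4_mult
  define P1 where "P1 = fps_X * theta_0 * (theta_e * theta_e * theta_e)"
  define P2 where "P2 = fps_X * theta_0 * (theta_e * theta_e * theta_o)"
  define P3 where "P3 = fps_X * theta_0 * (theta_e * (theta_o * theta_o))"
  define P4 where "P4 = fps_X * theta_0 * (theta_o * theta_o * theta_o)"
  have "exps_mod_4 ((1 + 0) + ((0 + 0) + 0)) P1" "exps_mod_4 ((1 + 0) + ((0 + 0) + 1)) P2"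
    "exps_mod_4 ((1 + 0) + (0 + (1 + 1))) P3" "exps_mod_4 ((1 + 0) + ((1 + 1) + 1)) P4"
    unfolding P1_def P2_def P3_def P4_def by (intro mult exps_mod_4_simps)+
  note this[THEN slice_exps_mod_4]
  then have s: "slice 1 P1 = P1" "slice 1 P2 = 0" "slice 1 P3 = 0" "slice 1 P4 = 0"
    "slice 2 P1 = 0" "slice 2 P2 = P2" "slice 2 P3 = 0" "slice 2 P4 = 0" by simp_all
  have c: "slice 1 (c5_series * theta_1) = slice 1 c5_series * theta_1"
    "slice 2 (c5_series * theta_1) = slice 2 c5_series * theta_1"
    by (rule slice_mult; simp add: exps_mod_4_simps)+
  have "c5_series * theta_1 - fps_X * theta_0 * (theta_e ^ 3 - theta_e\<^sup>2 * theta_o + theta_e * theta_o\<^sup>2 - theta_o ^ 3) =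
    c5_series * theta_1 - P1 + P2 - P3 + P4"
    by (simp add: P1_def P2_def P3_def P4_def power3_eq_cube power2_eq_square algebra_simps)
  then have "8 dvd slice r (c5_series * theta_1 - P1 + P2 - P3 + P4)" for r
    using numeral_dvd_slice[OF c5_series_cong_8, of r] by (simp only:)
  from this[of 1] this[of 2]
  have "8 dvd slice 1 c5_series * theta_1 - P1" "8 dvd slice 2 c5_series * theta_1 + P2"
    unfolding slice_simps s c by simp_all
  then show "8 dvd slice 1 c5_series * theta_1 - fps_X * theta_0 * theta_e ^ 3"
    "8 dvd slice 2 c5_series * theta_1 + fps_X * theta_0 * theta_e\<^sup>2 * theta_o"
    by (simp_all add: P1_def P2_def power3_eq_cube power2_eq_square mult.assoc)
qed

text \<open>The lowest term of \<open>theta_1\<close> is -q^4, from x = 1, so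
  \<open>numeral_dvd_fps_cancel\<close> applies.\<close>

lemma theta_1_cancel: "numeral k dvd theta_1 * g \<Longrightarrow> numeral k dvd g"
proof (rule numeral_dvd_fps_cancel[where d = 4 and f = theta_1])
  have x: "{x. x \<in> res_class 1 \<and> 4 * x\<^sup>2 = int 4} = {1}"
    by (auto simp: res_class_def power2_eq_1_iff)
  show "is_unit (theta_1 $ 4)" unfolding theta_1_def theta_def fps_nth_Abs_fps x by (simp add: weight_def)
  fix i :: nat assume "i < 4"
  show "theta_1 $ i = 0"
  proof (rule ccontr)
    assume "theta_1 $ i \<noteq> 0"
    then obtain x where "x \<in> res_class 1" "int i = 4 * x\<^sup>2" unfolding theta_1_def using theta_nth_neq_0 by blast
    moreover have "x \<noteq> 0" using calculation by (auto simp: res_class_def)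
    then have "x\<^sup>2 > 0" by simp
    ultimately show False using \<open>i < 4\<close> by linarith
  qed
qed

text \<open>\<open>theta_e - theta_1\<close> is divisible by 2, so its cube vanishes modulo 8. This
  expresses \<open>theta_e ^ 3\<close> as a multiple of \<open>theta_1\<close>, which is then
  cancelled.\<close>

lemma slice_1_c5_series:
  "8 dvd slice 1 c5_series - fps_X * (theta_0 * (3 * theta_e\<^sup>2 - 3 * (theta_e * theta_1) + theta_1\<^sup>2))"
proof (rule theta_1_cancel)
  obtain h where h: "theta_e - theta_1 = 2 * h" using theta_e_cong by (elim dvdE)
  have "8 dvd (slice 1 c5_series * theta_1 - fps_X * theta_0 * theta_e ^ 3) + 8 * (fps_X * theta_0 * h ^ 3)"
    using slice_c5_series(1) by (rule dvd_add) simp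
  also have "8 * (fps_X * theta_0 * h ^ 3) = fps_X * theta_0 * (2 * h) ^ 3" by (simp add: power_mult_distrib)
  also have "(slice 1 c5_series * theta_1 - fps_X * theta_0 * theta_e ^ 3) + fps_X * theta_0 * (2 * h) ^ 3 =
    theta_1 * (slice 1 c5_series - fps_X * (theta_0 * (3 * theta_e\<^sup>2 - 3 * (theta_e * theta_1) + theta_1\<^sup>2)))"
    unfolding h[symmetric] by (simp add: power3_eq_cube power2_eq_square algebra_simps)
  finally show "8 dvd theta_1 * (slice 1 c5_series - fps_X * (theta_0 * (3 * theta_e\<^sup>2 - 3 * (theta_e * theta_1) + theta_1\<^sup>2)))" .
qed

lemma theta_e_square_cong: "4 dvd theta_e\<^sup>2 - theta_1\<^sup>2"
proof -
  obtain h where "theta_e - theta_1 = 2 * h" using theta_e_cong by (elim dvdE)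
  then have e: "theta_e = theta_1 + 2 * h" by (simp add: algebra_simps)
  have "theta_e\<^sup>2 - theta_1\<^sup>2 = 4 * (theta_1 * h + h\<^sup>2)"
    unfolding e by (simp add: power2_eq_square algebra_simps)
  then show ?thesis by (rule dvdI)
qed

text \<open>Modulo 4 the squares of \<open>theta_e\<close> and \<open>theta_1\<close> agree, and one
  factor \<open>theta_1\<close> cancels.\<close>

lemma slice_2_c5_series:
  "4 dvd slice 2 c5_series + fps_X * (theta_0 * (theta_1 * theta_o))"
proof (rule theta_1_cancel)
  have "4 dvd (8 :: int fps)" by (rule dvdI[of _ _ 2]) simp
  then have "4 dvd (slice 2 c5_series * theta_1 + fps_X * theta_0 * theta_e\<^sup>2 * theta_o) - (fps_X * theta_0 * theta_o) * (theta_e\<^sup>2 - theta_1\<^sup>2)"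
    by (rule dvd_diff[OF dvd_trans[OF _ slice_c5_series(2)] dvd_mult[OF theta_e_square_cong]])
  also have "\<dots> = theta_1 * (slice 2 c5_series + fps_X * (theta_0 * (theta_1 * theta_o)))"
    by (simp add: power2_eq_square algebra_simps)
  finally show "4 dvd theta_1 * (slice 2 c5_series + fps_X * (theta_0 * (theta_1 * theta_o)))" .
qed

section \<open>Coefficients at M = 3N - 1\<close>

text \<open>\<open>c5 N\<close> sits at exponent 3N = M + 1 in \<open>c5_series\<close>; the factor
  \<open>fps_X\<close> in the congruences for the sections shifts this back to
  \<open>M\<close>.\<close>

lemma c5_eq_slice:
  assumes "3 * N = Suc M" "Suc M mod 4 = r"
  shows "c5 N = slice r c5_series $ Suc M"
proof -
  have "c5_series $ Suc M = c5 N"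
    unfolding c5_series_def assms(1)[symmetric] by (simp add: fps_nth_compose_X_power)
  then show ?thesis using assms(2) by (simp add: slice_def)
qed

lemma theta_support:
  "theta_e $ n \<noteq> 0 \<Longrightarrow> \<exists>x. int n = 4 * x\<^sup>2"
  "theta_o $ n \<noteq> 0 \<Longrightarrow> \<exists>x. int n = x\<^sup>2"
  "theta_1 $ n \<noteq> 0 \<Longrightarrow> \<exists>x. int n = 4 * x\<^sup>2"
  "theta_0 $ n \<noteq> 0 \<Longrightarrow> \<exists>x. int n = 4 * x\<^sup>2"
  "theta_0_half $ n \<noteq> 0 \<Longrightarrow> \<exists>x. int n = 4 * x\<^sup>2"
proof -
  show "\<exists>x. int n = 4 * x\<^sup>2" if n: "theta_e $ n \<noteq> 0"
  proof -
    from theta_nth_neq_0[OF n[unfolded theta_e_def]] obtain x where "even x" "int n = x\<^sup>2" by auto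
    moreover from \<open>even x\<close> obtain y where "x = 2 * y" by (elim evenE)
    ultimately have "int n = 4 * y\<^sup>2" by (simp add: power_mult_distrib)
    then show ?thesis by blast
  qed
qed (unfold theta_o_def theta_1_def theta_0_def theta_0_half_def, auto dest!: theta_nth_neq_0)

lemma fps_sum3_nth_neq_0:
  fixes f g h :: "'a :: comm_ring_1 fps"
  assumes "(f + g + h) $ n \<noteq> 0"
  shows "f $ n \<noteq> 0 \<or> g $ n \<noteq> 0 \<or> h $ n \<noteq> 0"
  using assms by (cases "f $ n = 0"; cases "g $ n = 0") auto

text \<open>\<open>theta_0\<close>, \<open>theta_e\<close> and \<open>theta_1\<close> have only
  exponents 4x^2. Apart from the factor \<open>fps_X\<close>, the series congruent to the section is
  a combination of products of three of them, so its coefficient at \<open>M\<close>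
  vanishes.\<close>

lemma eight_dvd_c5:
  assumes N: "3 * N = Suc M" "M mod 4 = 0"
    and ns: "\<And>a b c :: int. int M \<noteq> 4 * (a\<^sup>2 + b\<^sup>2 + c\<^sup>2)"
  shows "8 dvd c5 N"
proof -
  let ?g = "fps_const 3 * (theta_e * theta_e) + fps_const (- 3) * (theta_e * theta_1) + theta_1 * theta_1"
  have g: "3 * theta_e\<^sup>2 - 3 * (theta_e * theta_1) + theta_1\<^sup>2 = ?g"
    by (simp add: power2_eq_square numeral_fps_const fps_const_neg[symmetric] del: fps_const_neg)
  have "(theta_0 * ?g) $ M = 0"
  proof (rule ccontr)
    assume "(theta_0 * ?g) $ M \<noteq> 0"
    then obtain i j where ij: "M = i + j" "theta_0 $ i \<noteq> 0" "?g $ j \<noteq> 0" by (rule fps_mult_nth_neq_0E)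
    from fps_sum3_nth_neq_0[OF ij(3)]
    have "(theta_e * theta_e) $ j \<noteq> 0 \<or> (theta_e * theta_1) $ j \<noteq> 0 \<or> (theta_1 * theta_1) $ j \<noteq> 0"
      by auto
    then obtain f h :: "int fps" and i' j' where "f \<in> {theta_e, theta_1}" "h \<in> {theta_e, theta_1}" "j = i' + j'" "f $ i' \<noteq> 0" "h $ j' \<noteq> 0"
      by (elim disjE fps_mult_nth_neq_0E) blast+
    then obtain a b c where "int i = 4 * a\<^sup>2" "int i' = 4 * b\<^sup>2" "int j' = 4 * c\<^sup>2"
      using theta_support ij(2) by (metis insertE singletonD)
    then have "int M = 4 * (a\<^sup>2 + b\<^sup>2 + c\<^sup>2)" using ij(1) \<open>j = i' + j'\<close> by simp
    then show False using ns by blast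
  qed
  moreover have "8 dvd slice 1 c5_series $ Suc M - (fps_X * (theta_0 * ?g)) $ Suc M"
    using slice_1_c5_series unfolding g numeral_dvd_fps_iff fps_sub_nth by blast
  moreover have "Suc M mod 4 = 1" using N(2) by presburger
  ultimately show ?thesis using c5_eq_slice[OF N(1)] by simp
qed

text \<open>\<open>theta_1\<close> is a difference E - D, whose square is E^2 + D^2 modulo 2. By
  \<open>theta_even_odd\<close> that is the series at scale 8 times a series over multiples of 3,
  and the latter is 1 modulo 2.\<close>

lemma theta_1_square_cong: "2 dvd theta_1\<^sup>2 - theta 8 (res_class 1) (weight 1)"
proof -
  let ?E = "theta 4 (evens 1) (\<lambda>_. 1)" and ?D = "theta 4 (odds 1) (\<lambda>_. 1)"
  let ?A = "theta 8 (res_class 1) (weight 1)" and ?h = "theta 8 (res_class 0 \<inter> {x. x > 0}) (weight 1)"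
  have "?E * ?E + ?D * ?D = ?A * (1 + 2 * ?h)"
    using theta_even_odd[of 1 4 1] theta_0_eq[of 8 1] by simp
  then have "theta_1\<^sup>2 - ?A = 2 * (?A * ?h - ?E * ?D)"
    unfolding theta_1_def theta_weight(2)[OF zero_less_numeral]
    by (simp add: power2_eq_square algebra_simps)
  then show ?thesis by (rule dvdI)
qed

text \<open>Modulo 4 the quadratic expression in \<open>slice_1_c5_series\<close> reduces to
  \<open>theta_e * theta_1\<close>, and \<open>theta_0\<close> is
  \<open>1 + 2 * theta_0_half\<close>. In the doubled term \<open>theta_e * theta_1\<close> may be
  replaced modulo 2 by the series at scale 8. The two summands then have exponents 4(a^2 + b^2) and
  4(a^2 + 2b^2).\<close>

lemma four_dvd_c5_even:
  assumes N: "3 * N = Suc M" "M mod 4 = 0"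
    and ns: "\<And>a b :: int. int M \<noteq> 4 * (a\<^sup>2 + b\<^sup>2)" "\<And>a b :: int. int M \<noteq> 4 * (a\<^sup>2 + 2 * b\<^sup>2)"
  shows "4 dvd c5 N"
proof -
  let ?g = "3 * theta_e\<^sup>2 - 3 * (theta_e * theta_1) + theta_1\<^sup>2" and ?et = "theta_e * theta_1"
  let ?A = "theta 8 (res_class 1) (weight 1)"
  have 1: "?et $ M = 0"
  proof (rule ccontr)
    assume "?et $ M \<noteq> 0"
    then obtain i j where ij: "M = i + j" "theta_e $ i \<noteq> 0" "theta_1 $ j \<noteq> 0" by (rule fps_mult_nth_neq_0E)
    then obtain a b where "int i = 4 * a\<^sup>2" "int j = 4 * b\<^sup>2" using theta_support by metis
    then have "int M = 4 * (a\<^sup>2 + b\<^sup>2)" using ij(1) by simp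
    then show False using ns(1) by blast
  qed
  have 2: "(theta_0_half * ?A) $ M = 0"
  proof (rule ccontr)
    assume "(theta_0_half * ?A) $ M \<noteq> 0"
    then obtain i j where ij: "M = i + j" "theta_0_half $ i \<noteq> 0" "?A $ j \<noteq> 0" by (rule fps_mult_nth_neq_0E)
    then obtain a b where "int i = 4 * a\<^sup>2" "int j = 8 * b\<^sup>2" using theta_support(5) theta_nth_neq_0 by metis
    then have "int M = 4 * (a\<^sup>2 + 2 * b\<^sup>2)" using ij(1) by simp
    then show False using ns(2) by blast
  qed
  obtain h where h: "theta_e - theta_1 = 2 * h" using theta_e_cong by (elim dvdE)
  obtain l where l: "theta_1\<^sup>2 - ?A = 2 * l" using theta_1_square_cong by (elim dvdE)
  obtain m where m: "theta_e\<^sup>2 - theta_1\<^sup>2 = 4 * m" using theta_e_square_cong by (elim dvdE)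
  obtain s where s: "slice 1 c5_series - fps_X * (theta_0 * ?g) = 8 * s" using slice_1_c5_series by (elim dvdE)
  have et: "?et = ?A + 2 * (h * theta_1 + l)"
  proof -
    have "?et = ?A + (theta_1\<^sup>2 - ?A) + (theta_e - theta_1) * theta_1"
      by (simp add: power2_eq_square algebra_simps)
    then show ?thesis unfolding h l by (simp add: algebra_simps)
  qed
  let ?Y = "3 * m + theta_1\<^sup>2 - ?et" and ?W = "theta_0_half * (h * theta_1 + l)"
  have "?g = 3 * (theta_e\<^sup>2 - theta_1\<^sup>2) + 4 * theta_1\<^sup>2 - 4 * ?et + ?et" by (simp add: algebra_simps)
  then have g: "?g = 4 * ?Y + ?et" unfolding m by (simp add: algebra_simps)
  have "theta_0 * ?et = ?et + 2 * (theta_0_half * ?et)" unfolding theta_0_half by (simp add: algebra_simps)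
  also have "theta_0_half * ?et = theta_0_half * ?A + 2 * ?W"
    by (subst et) (simp add: algebra_simps)
  finally have t: "theta_0 * ?et = ?et + 2 * (theta_0_half * ?A) + 4 * ?W" by (simp only: distrib_left) simp
  have "theta_0 * ?g = 4 * (theta_0 * ?Y) + theta_0 * ?et"
    unfolding g by (simp only: distrib_left mult.left_commute)
  then have "(theta_0 * ?g) $ M = 4 * ((theta_0 * ?Y) $ M + ?W $ M)"
    using 1 2 unfolding t by (simp add: numeral_fps_const)
  then have "4 dvd (theta_0 * ?g) $ M" by (rule dvdI)
  moreover have "(slice 1 c5_series - fps_X * (theta_0 * ?g)) $ Suc M = 8 * s $ Suc M"
    unfolding s by (simp add: numeral_fps_const)
  then have "slice 1 c5_series $ Suc M = (theta_0 * ?g) $ M + 4 * (2 * s $ Suc M)" by simp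
  moreover have "Suc M mod 4 = 1" using N(2) by presburger
  ultimately show ?thesis using c5_eq_slice[OF N(1)] by simp
qed

text \<open>Every solution contributes an odd product of weights, so modulo 2 the coefficient is the
  number of solutions.\<close>

lemma even_theta_triple_nth:
  assumes pos: "t > 0" "s > 0" "r > 0" and odd: "\<And>x. odd (w x)" "\<And>x. odd (v x)" "\<And>x. odd (u x)"
  shows "even ((theta t S w * (theta s R v * theta r Q u)) $ n) \<longleftrightarrow>
    even (card {(x, y, z). x \<in> S \<and> y \<in> R \<and> z \<in> Q \<and> t * x\<^sup>2 + s * y\<^sup>2 + r * z\<^sup>2 = int n})"
proof -
  let ?S = "{x. x \<in> S \<and> t * x\<^sup>2 \<le> int n}"
  let ?P = "\<lambda>x. {(y, z). y \<in> R \<and> z \<in> Q \<and> s * y\<^sup>2 + r * z\<^sup>2 = int (n - nat (t * x\<^sup>2))}"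
  have fin: "finite ?S" by (rule finite_subset[OF _ finite_mult_square_le[OF pos(1)]]) auto
  have fin': "finite (?P x)" for x
    by (rule finite_subset[OF _ finite_square_pairs[OF pos(2,3)]]) auto
  have nn: "t * x\<^sup>2 \<ge> 0" "s * x\<^sup>2 \<ge> 0" "r * x\<^sup>2 \<ge> 0" for x using pos by simp_all
  have le: "t * x\<^sup>2 \<le> int n" if "t * x\<^sup>2 + s * y\<^sup>2 + r * z\<^sup>2 = int n" for x y z
    using that nn(2)[of y] nn(3)[of z] by linarith
  have eq: "{(x, y, z). x \<in> S \<and> y \<in> R \<and> z \<in> Q \<and> t * x\<^sup>2 + s * y\<^sup>2 + r * z\<^sup>2 = int n} = (SIGMA x:?S. ?P x)"
    using nn le by (auto simp: of_nat_diff nat_le_iff algebra_simps)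
  have "(theta t S w * (theta s R v * theta r Q u)) $ n = (\<Sum>x\<in>?S. \<Sum>(y, z)\<in>?P x. w x * (v y * u z))"
    unfolding theta_mult_nth[OF pos(1)] theta_mult_theta_nth[OF pos(2,3)]
    by (simp add: sum_distrib_left split_beta)
  also have "\<dots> = (\<Sum>(x, y, z)\<in>(SIGMA x:?S. ?P x). w x * (v y * u z))"
    using fin fin' by (subst sum.Sigma) auto
  finally have *: "(theta t S w * (theta s R v * theta r Q u)) $ n = (\<Sum>(x, y, z)\<in>(SIGMA x:?S. ?P x). w x * (v y * u z))" .
  have "finite (SIGMA x:?S. ?P x)" using fin fin' by blast
  then have "even (\<Sum>(x, y, z)\<in>(SIGMA x:?S. ?P x). w x * (v y * u z)) \<longleftrightarrow>
      even (card {a \<in> (SIGMA x:?S. ?P x). odd (case a of (x, y, z) \<Rightarrow> w x * (v y * u z))})"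
    by (rule even_sum_iff)
  also have "{a \<in> (SIGMA x:?S. ?P x). odd (case a of (x, y, z) \<Rightarrow> w x * (v y * u z))} = (SIGMA x:?S. ?P x)"
    using odd by auto
  finally show ?thesis unfolding * eq .
qed

text \<open>Write \<open>theta_0\<close> as \<open>1 + 2 * theta_0_half\<close>. The summand 1 leads
  to exponents a^2 + 4b^2, excluded by \<open>ns\<close>; the other one contributes twice a
  coefficient with the parity of the cardinality in \<open>even\<close>.\<close>

lemma four_dvd_c5_odd:
  assumes N: "3 * N = Suc M" "M mod 4 = 1"
    and ns: "\<And>a b :: int. int M \<noteq> a\<^sup>2 + 4 * b\<^sup>2"
    and even: "even (card {(z, y, x). z \<in> res_class 0 \<inter> {x. x > 0} \<and> y \<in> res_class 1 \<and> x \<in> odds 1 \<and> 4 * z\<^sup>2 + 4 * y\<^sup>2 + 1 * x\<^sup>2 = int M})"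
  shows "4 dvd c5 N"
proof -
  let ?to = "theta_1 * theta_o"
  have 1: "?to $ M = 0"
  proof (rule ccontr)
    assume "?to $ M \<noteq> 0"
    then obtain i j where ij: "M = i + j" "theta_1 $ i \<noteq> 0" "theta_o $ j \<noteq> 0" by (rule fps_mult_nth_neq_0E)
    then obtain a b where "int i = 4 * a\<^sup>2" "int j = b\<^sup>2" using theta_support by metis
    then have "int M = b\<^sup>2 + 4 * a\<^sup>2" using ij(1) by simp
    then show False using ns by blast
  qed
  have "even ((theta_0_half * ?to) $ M)"
    unfolding theta_0_half_def theta_1_def theta_o_def
    by (subst even_theta_triple_nth) (use even odd_psi_sign in \<open>auto simp: weight_def\<close>)
  then obtain h where h: "(theta_0_half * ?to) $ M = 2 * h" by (elim evenE)
  have "theta_0 * ?to = ?to + 2 * (theta_0_half * ?to)" unfolding theta_0_half by (simp add: algebra_simps)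
  then have "(theta_0 * ?to) $ M = 4 * h" using 1 h by (simp add: numeral_fps_const)
  moreover have "4 dvd slice 2 c5_series $ Suc M + (fps_X * (theta_0 * ?to)) $ Suc M"
    using slice_2_c5_series unfolding numeral_dvd_fps_iff fps_add_nth by blast
  moreover have "Suc M mod 4 = 2" using N(2) by presburger
  ultimately show ?thesis using c5_eq_slice[OF N(1)] by (simp add: dvd_add_left_iff)
qed

section \<open>Values not represented by sums of squares\<close>

text \<open>Squares are 0 or 1 modulo 4, so three squares with sum divisible by 4 are all even; each
  step removes one factor 4.\<close>

lemma three_squares_descent:
  fixes a b c m :: int
  assumes "a\<^sup>2 + b\<^sup>2 + c\<^sup>2 = 4 ^ k * m"
  obtains a' b' c' where "a = 2 ^ k * a'" "b = 2 ^ k * b'" "c = 2 ^ k * c'" "a'\<^sup>2 + b'\<^sup>2 + c'\<^sup>2 = m"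
  using assms
proof (induction k arbitrary: a b c thesis)
  case 0
  then show ?case by simp
next
  case (Suc k)
  have s: "x\<^sup>2 mod 4 = (if even x then 0 else 1)" for x :: int
    by (cases "even x") (auto elim!: evenE simp: power_mult_distrib odd_square_mod_4)
  have "(a\<^sup>2 mod 4 + b\<^sup>2 mod 4 + c\<^sup>2 mod 4) mod 4 = (a\<^sup>2 + b\<^sup>2 + c\<^sup>2) mod 4"
    by (rule mod_add_cong[OF mod_add_cong[OF mod_mod_trivial mod_mod_trivial] mod_mod_trivial])
  also have "\<dots> = 0" unfolding Suc.prems(2) by simp
  finally have "even a" "even b" "even c" unfolding s by (auto split: if_splits)
  then obtain x y z where xyz: "a = 2 * x" "b = 2 * y" "c = 2 * z" by (elim evenE)
  then have "x\<^sup>2 + y\<^sup>2 + z\<^sup>2 = 4 ^ k * m" using Suc.prems(2) by (simp add: power_mult_distrib)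
  from Suc.IH[OF _ this] obtain a' b' c' where "x = 2 ^ k * a'" "y = 2 ^ k * b'" "z = 2 ^ k * c'" "a'\<^sup>2 + b'\<^sup>2 + c'\<^sup>2 = m"
    by blast
  then show ?case using Suc.prems(1)[of a' b' c'] unfolding xyz by simp
qed

text \<open>After the descent, three residues from 0, 1, 4 would have to sum to 7 modulo 8.\<close>

lemma not_three_squares:
  fixes a b c m :: int
  assumes "m mod 8 = 7"
  shows "a\<^sup>2 + b\<^sup>2 + c\<^sup>2 \<noteq> 4 ^ k * m"
proof
  assume "a\<^sup>2 + b\<^sup>2 + c\<^sup>2 = 4 ^ k * m"
  then obtain a b c where abc: "a\<^sup>2 + b\<^sup>2 + c\<^sup>2 = m" by (rule three_squares_descent)
  have "(a\<^sup>2 mod 8 + b\<^sup>2 mod 8 + c\<^sup>2 mod 8) mod 8 = (a\<^sup>2 + b\<^sup>2 + c\<^sup>2) mod 8"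
    by (rule mod_add_cong[OF mod_add_cong[OF mod_mod_trivial mod_mod_trivial] mod_mod_trivial])
  also have "\<dots> = 7" unfolding abc by fact
  finally show False
    using mod_square_cases(4)[of a] mod_square_cases(4)[of b] mod_square_cases(4)[of c]
    by (elim insertE[of "a\<^sup>2 mod 8"] insertE[of "b\<^sup>2 mod 8"] insertE[of "c\<^sup>2 mod 8"] emptyE) simp_all
qed

text \<open>Both forms are sums of three squares, of a, b, 0 and of a, b, b. The descent preserves
  these shapes, and the squares 0, 1, 4, 9 modulo 16 never combine to 14.\<close>

lemma not_two_squares:
  fixes a b m :: int
  assumes "m mod 16 = 14"
  shows "a\<^sup>2 + b\<^sup>2 \<noteq> 4 ^ k * m" "a\<^sup>2 + 2 * b\<^sup>2 \<noteq> 4 ^ k * m"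
proof -
  show "a\<^sup>2 + b\<^sup>2 \<noteq> 4 ^ k * m"
  proof
    assume "a\<^sup>2 + b\<^sup>2 = 4 ^ k * m"
    then have "a\<^sup>2 + b\<^sup>2 + 0\<^sup>2 = 4 ^ k * m" by simp
    then obtain a b c where abc: "0 = 2 ^ k * c" "a\<^sup>2 + b\<^sup>2 + c\<^sup>2 = m" by (rule three_squares_descent)
    have "(a\<^sup>2 mod 16 + b\<^sup>2 mod 16) mod 16 = (a\<^sup>2 + b\<^sup>2) mod 16" by (simp add: mod_simps)
    also have "a\<^sup>2 + b\<^sup>2 = m" using abc by simp
    finally have "(a\<^sup>2 mod 16 + b\<^sup>2 mod 16) mod 16 = 14" using assms by simp
    then show False using mod_square_cases(5)[of a] mod_square_cases(5)[of b]
      by (elim insertE[of "a\<^sup>2 mod 16"] insertE[of "b\<^sup>2 mod 16"] emptyE) simp_all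
  qed
  show "a\<^sup>2 + 2 * b\<^sup>2 \<noteq> 4 ^ k * m"
  proof
    assume "a\<^sup>2 + 2 * b\<^sup>2 = 4 ^ k * m"
    then have "a\<^sup>2 + b\<^sup>2 + b\<^sup>2 = 4 ^ k * m" by simp
    then obtain a' b' c' where abc: "b = 2 ^ k * b'" "b = 2 ^ k * c'" "a'\<^sup>2 + b'\<^sup>2 + c'\<^sup>2 = m" by (rule three_squares_descent)
    have "(a'\<^sup>2 mod 16 + 2 * (b'\<^sup>2 mod 16)) mod 16 = (a'\<^sup>2 + 2 * b'\<^sup>2) mod 16"
      by (rule mod_add_cong[OF mod_mod_trivial mod_mult_right_eq])
    also have "a'\<^sup>2 + 2 * b'\<^sup>2 = m" using abc by simp
    finally have "(a'\<^sup>2 mod 16 + 2 * (b'\<^sup>2 mod 16)) mod 16 = 14" using assms by simp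
    then show False using mod_square_cases(5)[of a'] mod_square_cases(5)[of b']
      by (elim insertE[of "a'\<^sup>2 mod 16"] insertE[of "b'\<^sup>2 mod 16"] emptyE) simp_all
  qed
qed

section \<open>The arithmetic progressions of the theorem\<close>

text \<open>If 7k were x^2 + 4y^2, then 7 would divide x and y, hence \<open>k\<close>. The
  solutions counted in \<open>four_dvd_c5_odd\<close> correspond to the positive solutions of x^2 +
  4y^2 + 36z^2 = 7k, whose number is even by \<open>even_card_1_4_36\<close>.\<close>

lemma four_dvd_c5_seven:
  assumes N: "3 * N = Suc (7 * k)" and k: "k mod 12 = 11" "k mod 7 \<in> {3, 5, 6}"
  shows "4 dvd c5 N"
proof (rule four_dvd_c5_odd[OF N])
  have "k mod 4 = 3" and k3: "k mod 3 = 2" and "odd k" using k(1) by presburger+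
  then show "7 * k mod 4 = 1" by presburger
  have "int k mod 12 = int (k mod 12)" "int k mod 7 = int (k mod 7)" by (simp_all add: zmod_int)
  then have ki: "int k mod 12 = 11" "int k mod 7 \<in> {3, 5, 6}" using k by auto
  show "int (7 * k) \<noteq> a\<^sup>2 + 4 * b\<^sup>2" for a b :: int
  proof
    assume eq: "int (7 * k) = a\<^sup>2 + 4 * b\<^sup>2"
    then have "a\<^sup>2 + 4 * b\<^sup>2 = 7 * int k" by simp
    then have "7 dvd a \<and> 7 dvd b" by (intro seven_dvd_norm) simp
    then obtain x y where "a = 7 * x" "b = 7 * y" by (auto elim!: dvdE)
    then have "int k = 7 * (x\<^sup>2 + 4 * y\<^sup>2)" using eq by (simp add: power_mult_distrib)
    then have "int k mod 7 = 0" by simp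
    then show False using ki by simp
  qed
  let ?T = "{(z, y, x). z \<in> res_class 0 \<inter> {x. x > 0} \<and> y \<in> res_class 1 \<and> x \<in> odds 1 \<and> 4 * z\<^sup>2 + 4 * y\<^sup>2 + 1 * x\<^sup>2 = int (7 * k)}"
  let ?P = "{(z, x, y). z > 0 \<and> x > 0 \<and> y > 0 \<and> x\<^sup>2 + 4 * y\<^sup>2 + 36 * z\<^sup>2 = 7 * int k}"
  \<comment> \<open>Restores the sign lost in the absolute value: if 3 does not divide
    \<open>x\<close>, exactly one of \<open>x\<close> and \<open>- x\<close> is 1 modulo 3.\<close>
  define sel where "sel x = (if x mod 3 = 1 then x else - x)" for x :: int
  have sel: "sel \<bar>x\<bar> = x" if "x mod 3 = 1" for x
  proof (cases "x \<ge> 0")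
    case False
    have "(- x) mod 3 \<noteq> 1" using that by presburger
    then show ?thesis using False by (simp add: sel_def)
  qed (use that in \<open>simp add: sel_def\<close>)
  have sel_mod: "sel x mod 3 = 1" if "x mod 3 \<noteq> 0" for x
  proof (cases "x mod 3 = 1")
    case False
    then have "(- x) mod 3 = 1" using that by presburger
    then show ?thesis using False by (simp add: sel_def)
  qed (simp add: sel_def)
  have "bij_betw (\<lambda>(z, y, x). (z div 3, \<bar>x\<bar>, \<bar>y\<bar>)) ?T ?P"
  proof (rule bij_betw_byWitness[where f' = "\<lambda>(z, x, y). (3 * z, sel y, sel x)"])
    show "\<forall>p\<in>?T. (case case p of (z, y, x) \<Rightarrow> (z div 3, \<bar>x\<bar>, \<bar>y\<bar>) of (z, x, y) \<Rightarrow> (3 * z, sel y, sel x)) = p"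
      by (auto simp: res_class_def sel)
    show "\<forall>p\<in>?P. (case case p of (z, x, y) \<Rightarrow> (3 * z, sel y, sel x) of (z, y, x) \<Rightarrow> (z div 3, \<bar>x\<bar>, \<bar>y\<bar>)) = p"
      by (auto simp: sel_def)
    show "(\<lambda>(z, y, x). (z div 3, \<bar>x\<bar>, \<bar>y\<bar>)) ` ?T \<subseteq> ?P"
    proof (rule image_subsetI)
      fix p assume "p \<in> ?T"
      then obtain z y x where p: "p = (z, y, x)" and "z mod 3 = 0" "0 < z" and xy: "y mod 3 = 1" "x mod 3 = 1"
        and eq: "4 * z\<^sup>2 + 4 * y\<^sup>2 + x\<^sup>2 = 7 * int k" by (auto simp: res_class_def)
      then have "z = 3 * (z div 3)" by presburger
      then obtain w where w: "z = 3 * w" by blast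
      then have "w > 0" using \<open>z > 0\<close> by simp
      moreover have "x \<noteq> 0" "y \<noteq> 0" using xy by auto
      ultimately show "(case p of (z, y, x) \<Rightarrow> (z div 3, \<bar>x\<bar>, \<bar>y\<bar>)) \<in> ?P"
        using eq unfolding p w by (simp add: power_mult_distrib)
    qed
    show "(\<lambda>(z, x, y). (3 * z, sel y, sel x)) ` ?P \<subseteq> ?T"
    proof (rule image_subsetI)
      fix p assume "p \<in> ?P"
      then obtain z x y where p: "p = (z, x, y)" and "0 < z"
        and eq: "x\<^sup>2 + 4 * y\<^sup>2 + 36 * z\<^sup>2 = 7 * int k" by auto
      \<comment> \<open>Modulo 3 the equation says x^2 + y^2 = 2, so 3 divides neither
        \<open>x\<close> nor \<open>y\<close>.\<close>
      have "x\<^sup>2 + y\<^sup>2 + 3 * (y\<^sup>2 + 12 * z\<^sup>2) = 7 * int k" using eq by simp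
      then have "(x\<^sup>2 + y\<^sup>2 + 3 * (y\<^sup>2 + 12 * z\<^sup>2)) mod 3 = (7 * int k) mod 3" by simp
      also have "(7 * int k) mod 3 = int ((7 * k) mod 3)" by (simp add: zmod_int)
      also have "(7 * k) mod 3 = 2" using k3 by presburger
      finally have "(x\<^sup>2 + y\<^sup>2) mod 3 = 2" by (simp only: mod_mult_self2)
      then have "(x\<^sup>2 mod 3 + y\<^sup>2 mod 3) mod 3 = 2" by (simp only: mod_add_eq)
      then have "x\<^sup>2 mod 3 = 1" "y\<^sup>2 mod 3 = 1" using mod_square_cases(1)[of x] mod_square_cases(1)[of y]
        by (elim insertE[of "x\<^sup>2 mod 3"] insertE[of "y\<^sup>2 mod 3"] emptyE; simp)+
      moreover have "v\<^sup>2 mod 3 = 0" if "v mod 3 = 0" for v :: int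
        using that by (simp add: power2_eq_square flip: dvd_eq_mod_eq_0)
      ultimately have "x mod 3 \<noteq> 0" "y mod 3 \<noteq> 0" by force+
      then have "sel x mod 3 = 1" "sel y mod 3 = 1" by (simp_all add: sel_mod)
      moreover have "odd x"
      proof -
        have "x\<^sup>2 = 7 * int k - 2 * (2 * y\<^sup>2 + 18 * z\<^sup>2)" using eq by simp
        also have "odd \<dots>" using \<open>odd k\<close> by simp
        finally show ?thesis by simp
      qed
      then have "odd (sel x)" by (simp add: sel_def)
      moreover have "(sel x)\<^sup>2 = x\<^sup>2" "(sel y)\<^sup>2 = y\<^sup>2" by (simp_all add: sel_def)
      ultimately show "(case p of (z, x, y) \<Rightarrow> (3 * z, sel y, sel x)) \<in> ?T"
        using eq \<open>0 < z\<close> unfolding p res_class_def by (simp add: power_mult_distrib)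
    qed
  qed
  then have "card ?T = card ?P" by (rule bij_betw_same_card)
  then show "even (card ?T)" using even_card_1_4_36[OF ki] by simp
qed

theorem theorem1p1:
  "\<forall>n::nat.
     [c5 (32 * n + 31) = 0] (mod 8) \<and>
     [c5 (128 * n + 123) = 0] (mod 8) \<and>
     [c5 (512 * n + 491) = 0] (mod 8) \<and>
     [c5 (64 * n + 19) = 0] (mod 4) \<and>
     [c5 (256 * n + 75) = 0] (mod 4) \<and>
     (\<forall>i\<in>{110, 138, 194}. [c5 (196 * n + i) = 0] (mod 4))"
proof
  fix n :: nat
  have m8: "(24 * int n + 23) mod 8 = 7" and m16: "(48 * int n + 14) mod 16 = 14" by presburger+
  \<comment> \<open>For N = 32n + 31, 128n + 123, 512n + 491 the number 3N - 1 has this form with k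
    = 0, 1, 2.\<close>
  have 8: "8 dvd c5 N" if "3 * N = Suc (4 * 4 ^ k * (24 * n + 23))" for N k
  proof (rule eight_dvd_c5[OF that])
    fix a b c :: int
    show "int (4 * 4 ^ k * (24 * n + 23)) \<noteq> 4 * (a\<^sup>2 + b\<^sup>2 + c\<^sup>2)"
      using not_three_squares[OF m8, of a b c k] by simp
  qed simp
  \<comment> \<open>For N = 64n + 19 and 256n + 75 the number 3N - 1 has this form with k = 0,
    1.\<close>
  have 4: "4 dvd c5 N" if "3 * N = Suc (4 * 4 ^ k * (48 * n + 14))" for N k
  proof (rule four_dvd_c5_even[OF that])
    fix a b :: int
    show "int (4 * 4 ^ k * (48 * n + 14)) \<noteq> 4 * (a\<^sup>2 + b\<^sup>2)"
      "int (4 * 4 ^ k * (48 * n + 14)) \<noteq> 4 * (a\<^sup>2 + 2 * b\<^sup>2)"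
      using not_two_squares[OF m16, of a b k] by simp_all
  qed simp
  have "8 dvd c5 (32 * n + 31)" using 8[of "32 * n + 31" 0] by simp
  moreover have "8 dvd c5 (128 * n + 123)" using 8[of "128 * n + 123" 1] by simp
  moreover have "8 dvd c5 (512 * n + 491)" using 8[of "512 * n + 491" 2] by simp
  moreover have "4 dvd c5 (64 * n + 19)" using 4[of "64 * n + 19" 0] by simp
  moreover have "4 dvd c5 (256 * n + 75)" using 4[of "256 * n + 75" 1] by simp
  moreover have "4 dvd c5 (196 * n + i)" if "i \<in> {110, 138, 194}" for i
  proof -
    \<comment> \<open>Here 3N - 1 = 7k with k = 84n + 47, 84n + 59, 84n + 83; these are 11 modulo 12
      and 5, 3, 6 modulo 7.\<close>
    have "84 * n + j = j + 12 * (7 * n)" "84 * n + j = j + 7 * (12 * n)" for j by simp_all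
    then have k: "(84 * n + j) mod 12 = j mod 12" "(84 * n + j) mod 7 = j mod 7" for j
      by (metis mod_mult_self2)+
    show ?thesis
      using that four_dvd_c5_seven[of "196 * n + 110" "84 * n + 47"] four_dvd_c5_seven[of "196 * n + 138" "84 * n + 59"]
        four_dvd_c5_seven[of "196 * n + 194" "84 * n + 83"]
      unfolding k by auto
  qed
  ultimately show "[c5 (32 * n + 31) = 0] (mod 8) \<and>
     [c5 (128 * n + 123) = 0] (mod 8) \<and>
     [c5 (512 * n + 491) = 0] (mod 8) \<and>
     [c5 (64 * n + 19) = 0] (mod 4) \<and>
     [c5 (256 * n + 75) = 0] (mod 4) \<and>
     (\<forall>i\<in>{110, 138, 194}. [c5 (196 * n + i) = 0] (mod 4))"
    by (simp add: cong_0_iff)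
qed

end
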